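(* Let $G$ be a compact group with identity $e$ and Haar probability measure $\nu$, let $A \subset G$ with $A = A^{-1}$ and $e \in A$, and let $W \leq G$ be a closed subgroup with $wA = Aw = A$ for all $w \in W$. Consider the dual problem: the supremum of $c \in \mathbb{R}$ over pairs $(c,\mu)$ where $\mu$ is a nonnegative Radon measure on $G$ supported in $\overline{A^c}$ with $\delta_e + \mu - c\nu \in \mathcal{M}_{\succeq 0}(G)$. The value of this supremum is unchanged if one additionally requires $L_w^*\mu = R_w^*\mu = \mu$ for all $w \in W$.
   Context: $\mathcal{M}_{\succeq 0}(G)$ is the set of Radon measures $\lambda$ on $G$ with $\int_G f\,d\lambda \geq 0$ for all continuous positive definite $f$ (i.e., $\sum_{i,j}\overline{c_i}f(g_i^{-1}g_j)c_j\geq 0$ for all finite choices); equivalently, $\int_G \pi(g)\,d\lambda(g) \succeq 0$ for every irreducible unitary representation $\pi$. $\delta_e$ is the Dirac mass at $e$. For $w \in G$, $L_w^*\mu$ and $R_w^*\mu$ are the measures defined by $\int f\, dL_w^*\mu = \int f(w^{-1}g)\,d\mu(g)$ and $\int f\, dR_w^*\mu = \int f(gw)\,d\mu(g)$ for $f \in C(G)$. *)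

theory Defs
  imports "HOL-Analysis.Analysis"
begin

text \<open>Groups are written additively (type class group_add, not assumed commutative):
  the group product gh is g + h, the identity e is 0, the inverse is uminus.\<close>

definition cnonneg :: "complex \<Rightarrow> bool" where
  "cnonneg z \<longleftrightarrow> Im z = 0 \<and> 0 \<le> Re z"

definition pos_def_fun :: "('g::group_add \<Rightarrow> complex) \<Rightarrow> bool" where
  "pos_def_fun f \<longleftrightarrow>
     (\<forall>(n::nat) (c::nat \<Rightarrow> complex) (g::nat \<Rightarrow> 'g).
        cnonneg (\<Sum>i<n. \<Sum>j<n. cnj (c i) * f (- g i + g j) * c j))"

text \<open>Finite Radon measure on a compact Hausdorff space: a finite Borel measure that is
  inner regular by compact sets on all Borel sets (equivalent to the usual definition for
  finite measures).\<close>
definition radon :: "'g::topological_space measure \<Rightarrow> bool" where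
  "radon \<mu> \<longleftrightarrow> sets \<mu> = sets borel \<and> emeasure \<mu> (space \<mu>) < \<infinity> \<and>
     (\<forall>B\<in>sets borel. emeasure \<mu> B = (SUP K\<in>{K. K \<subseteq> B \<and> compact K}. emeasure \<mu> K))"

definition compact_group :: "'g::{group_add,t2_space} itself \<Rightarrow> bool" where
  "compact_group _ \<longleftrightarrow> compact (UNIV :: 'g set) \<and>
     continuous_on UNIV (\<lambda>p::'g \<times> 'g. fst p + snd p) \<and>
     continuous_on UNIV (uminus :: 'g \<Rightarrow> 'g)"

definition haar_prob :: "'g::{group_add,t2_space} measure \<Rightarrow> bool" where
  "haar_prob \<nu> \<longleftrightarrow> radon \<nu> \<and> emeasure \<nu> UNIV = 1 \<and>
     (\<forall>g. \<forall>B\<in>sets borel. emeasure \<nu> ((\<lambda>x. g + x) ` B) = emeasure \<nu> B \<and>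
                          emeasure \<nu> ((\<lambda>x. x + g) ` B) = emeasure \<nu> B)"

text \<open>The measure lambda = delta_e + mu - c nu is in M_{\<succeq>0}(G): integral of every continuous
  positive definite function is nonnegative.\<close>
definition dual_psd :: "'g::{group_add,t2_space} measure \<Rightarrow> real \<Rightarrow> 'g measure \<Rightarrow> bool" where
  "dual_psd \<nu> c \<mu> \<longleftrightarrow>
     (\<forall>f::'g \<Rightarrow> complex. continuous_on UNIV f \<and> pos_def_fun f \<longrightarrow>
        cnonneg (f 0 + integral\<^sup>L \<mu> f - of_real c * integral\<^sup>L \<nu> f))"

definition dual_feasible :: "'g::{group_add,t2_space} measure \<Rightarrow> 'g set \<Rightarrow> real \<Rightarrow> 'g measure \<Rightarrow> bool" where
  "dual_feasible \<nu> A c \<mu> \<longleftrightarrow> radon \<mu> \<and>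
     emeasure \<mu> (UNIV - closure (UNIV - A)) = 0 \<and> dual_psd \<nu> c \<mu>"

definition Lpull :: "'g::{group_add,topological_space} \<Rightarrow> 'g measure \<Rightarrow> 'g measure" where
  "Lpull w \<mu> = distr \<mu> borel (\<lambda>g. - w + g)"

definition Rpull :: "'g::{group_add,topological_space} \<Rightarrow> 'g measure \<Rightarrow> 'g measure" where
  "Rpull w \<mu> = distr \<mu> borel (\<lambda>g. g + w)"

end

theory Submission
  imports Defs
begin

text \<open>
  For a probability measure \<open>p\<close> supported in \<open>W\<close> with mirror image \<open>p*\<close>, replace \<open>\<mu>\<close> by the
  convolution \<open>p * \<mu> * p*\<close>. This keeps the support, because \<open>W\<close> preserves the closure of the
  complement of \<open>A\<close>, and it keeps \<open>\<delta>\<^sub>e + \<mu> - c\<nu>\<close> positive semidefinite: sandwiching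
  \<open>\<delta>\<^sub>e + \<mu> - c\<nu>\<close> between \<open>p\<close> and \<open>p*\<close> preserves positivity and fixes \<open>\<nu>\<close>, and
  \<open>\<delta>\<^sub>e - p * p*\<close> is positive semidefinite. No Haar measure on \<open>W\<close> is needed: if \<open>p\<close> is
  the uniform distribution on a fine enough finite net of \<open>W\<close>, iterating this operation contracts
  the oscillation of the functional along \<open>W\<close> on any equicontinuous class of functions, so one
  obtains feasible functionals that are almost \<open>W\<close>-invariant on finitely many continuous functions.
  Tychonoff compactness of the set of feasible functionals yields an exactly invariant one, which
  the Riesz construction turns into a Radon measure.
\<close>

subsection \<open>Positive functionals and Radon measures\<close>

text \<open>A compact Hausdorff space is normal, so Urysohn's lemma for abstract topologies applies
  to \<open>euclidean\<close>; its interval-valued map is unpacked into plain bounds.\<close>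

lemma compact_t2_Urysohn:
  fixes S T :: "'a::t2_space set"
  assumes "compact (UNIV :: 'a set)" "closed S" "closed T" "S \<inter> T = {}"
  obtains h :: "'a \<Rightarrow> real" where "continuous_on UNIV h" "\<And>x. 0 \<le> h x" "\<And>x. h x \<le> 1"
    "\<And>x. x \<in> S \<Longrightarrow> h x = 0" "\<And>x. x \<in> T \<Longrightarrow> h x = 1"
proof -
  have "Hausdorff_space (euclidean :: 'a topology)"
    unfolding Hausdorff_space_def disjnt_def
    using hausdorff by (metis open_openin)
  moreover have "compact_space (euclidean :: 'a topology)"
    using assms(1) by (simp add: compact_space_def)
  ultimately have "normal_space (euclidean :: 'a topology)"
    using compact_Hausdorff_or_regular_imp_normal_space by blast
  then obtain h :: "'a \<Rightarrow> real"
    where h: "continuous_map euclidean (top_of_set {0..1}) h" "h ` S \<subseteq> {0}" "h ` T \<subseteq> {1}"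
    using Urysohn_lemma[of euclidean S T 0 1] assms
    by (metis closed_closedin disjnt_def zero_le_one)
  show thesis
  proof (rule that[of h])
    show "continuous_on UNIV h"
      using h(1) by (simp add: continuous_map_in_subtopology)
    have "h x \<in> {0..1}" for x
      using h(1) by (auto simp: continuous_map_in_subtopology)
    then show "0 \<le> h x" "h x \<le> 1" for x
      by auto
  qed (use h in auto)
qed

section \<open>Algebra and order of positive functionals on continuous functions\<close>

definition positive_functional :: "(('g::topological_space \<Rightarrow> real) \<Rightarrow> real) \<Rightarrow> bool" where
  "positive_functional \<phi> \<longleftrightarrow>
     (\<forall>f g. continuous_on UNIV f \<longrightarrow> continuous_on UNIV g \<longrightarrow> \<phi> (\<lambda>x. f x + g x) = \<phi> f + \<phi> g) \<and>
     (\<forall>f a. continuous_on UNIV f \<longrightarrow> \<phi> (\<lambda>x. a * f x) = a * \<phi> f) \<and>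
     (\<forall>f. continuous_on UNIV f \<longrightarrow> (\<forall>x. 0 \<le> f x) \<longrightarrow> 0 \<le> \<phi> f)"

lemma positive_functional_add:
  "positive_functional \<phi> \<Longrightarrow> continuous_on UNIV f \<Longrightarrow> continuous_on UNIV g \<Longrightarrow>
    \<phi> (\<lambda>x. f x + g x) = \<phi> f + \<phi> g"
  by (simp add: positive_functional_def)

lemma positive_functional_scale:
  "positive_functional \<phi> \<Longrightarrow> continuous_on UNIV f \<Longrightarrow> \<phi> (\<lambda>x. a * f x) = a * \<phi> f"
  by (simp add: positive_functional_def)

lemma positive_functional_nonneg:
  "positive_functional \<phi> \<Longrightarrow> continuous_on UNIV f \<Longrightarrow> (\<And>x. 0 \<le> f x) \<Longrightarrow> 0 \<le> \<phi> f"
  by (simp add: positive_functional_def)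

lemma positive_functional_zero: "positive_functional \<phi> \<Longrightarrow> \<phi> (\<lambda>x. 0) = 0"
  using positive_functional_scale[of \<phi> "\<lambda>x. 0" 0] by simp

lemma positive_functional_diff:
  assumes "positive_functional \<phi>" "continuous_on UNIV f" "continuous_on UNIV g"
  shows "\<phi> (\<lambda>x. f x - g x) = \<phi> f - \<phi> g"
proof -
  have "\<phi> (\<lambda>x. f x + (-1) * g x) = \<phi> f + \<phi> (\<lambda>x. (-1) * g x)"
    using assms by (intro positive_functional_add[OF assms(1)] continuous_intros)
  then show ?thesis
    using positive_functional_scale[OF assms(1,3), of "-1"] by simp
qed

lemma positive_functional_mono:
  assumes "positive_functional \<phi>" "continuous_on UNIV f" "continuous_on UNIV g" "\<And>x. f x \<le> g x"
  shows "\<phi> f \<le> \<phi> g"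
proof -
  have "0 \<le> \<phi> (\<lambda>x. g x - f x)"
    using assms by (intro positive_functional_nonneg[OF assms(1)] continuous_intros) auto
  then show ?thesis
    using positive_functional_diff[OF assms(1,3,2)] by simp
qed

lemma positive_functional_const: "positive_functional \<phi> \<Longrightarrow> \<phi> (\<lambda>x. a) = a * \<phi> (\<lambda>x. 1)"
  using positive_functional_scale[of \<phi> "\<lambda>x. 1" a] by simp

lemma positive_functional_sum:
  assumes "positive_functional \<phi>" "finite I" "\<And>i. i \<in> I \<Longrightarrow> continuous_on UNIV (f i)"
  shows "\<phi> (\<lambda>x. \<Sum>i\<in>I. f i x) = (\<Sum>i\<in>I. \<phi> (f i))"
  using assms(2,3)
proof (induction I rule: finite_induct)
  case empty
  then show ?case by (simp add: positive_functional_zero assms(1))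
next
  case (insert i I)
  then have "\<phi> (\<lambda>x. f i x + (\<Sum>i\<in>I. f i x)) = \<phi> (f i) + \<phi> (\<lambda>x. \<Sum>i\<in>I. f i x)"
    by (intro positive_functional_add[OF assms(1)] continuous_on_sum) auto
  then show ?case
    using insert by simp
qed

text \<open>A uniform pointwise error \<open>e\<close> costs at most \<open>e\<close> times the
  total mass \<open>\<phi> (\<lambda>x. 1)\<close>. The later approximation estimates all go through
  this form.\<close>

lemma positive_functional_le_diff:
  assumes "positive_functional \<phi>" "continuous_on UNIV f" "continuous_on UNIV g"
    and "\<And>x. f x \<le> g x + e"
  shows "\<phi> f \<le> \<phi> g + e * \<phi> (\<lambda>x. 1)"
proof -
  have "\<phi> f \<le> \<phi> (\<lambda>x. g x + e)"
    using assms by (intro positive_functional_mono[OF assms(1)] continuous_intros) auto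
  also have "\<dots> = \<phi> g + \<phi> (\<lambda>x. e)"
    using assms by (intro positive_functional_add[OF assms(1)] continuous_intros)
  finally show ?thesis
    using positive_functional_const[OF assms(1), of e] by simp
qed

section \<open>The Riesz-Markov outer measure of a positive functional\<close>

definition open_content :: "(('g::topological_space \<Rightarrow> real) \<Rightarrow> real) \<Rightarrow> 'g set \<Rightarrow> ennreal" where
  "open_content \<phi> V =
     (SUP f\<in>{f. continuous_on UNIV f \<and> (\<forall>x. 0 \<le> f x \<and> f x \<le> indicator V x)}. ennreal (\<phi> f))"

definition riesz_outer :: "(('g::topological_space \<Rightarrow> real) \<Rightarrow> real) \<Rightarrow> 'g set \<Rightarrow> ennreal" where
  "riesz_outer \<phi> B = (INF V\<in>{V. open V \<and> B \<subseteq> V}. open_content \<phi> V)"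

definition riesz_measure :: "(('g::topological_space \<Rightarrow> real) \<Rightarrow> real) \<Rightarrow> 'g measure" where
  "riesz_measure \<phi> = measure_of UNIV (sets borel) (riesz_outer \<phi>)"

lemma open_content_upper:
  assumes "continuous_on UNIV f" "\<And>x. 0 \<le> f x" "\<And>x. f x \<le> indicator V x"
  shows "ennreal (\<phi> f) \<le> open_content \<phi> V"
  unfolding open_content_def using assms by (intro SUP_upper) auto

lemma open_content_mono: "V \<subseteq> V' \<Longrightarrow> open_content \<phi> V \<le> open_content \<phi> V'"
  unfolding open_content_def
proof (intro SUP_subset_mono order_refl subsetI)
  fix f assume "V \<subseteq> V'" "f \<in> {f. continuous_on UNIV f \<and> (\<forall>x. 0 \<le> f x \<and> f x \<le> indicat_real V x)}"
  moreover from this have "indicat_real V x \<le> indicator V' x" for x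
    by (auto simp: indicator_def)
  ultimately show "f \<in> {f. continuous_on UNIV f \<and> (\<forall>x. 0 \<le> f x \<and> f x \<le> indicat_real V' x)}"
    using order_trans by blast
qed

lemma riesz_outer_open: "open V \<Longrightarrow> riesz_outer \<phi> V = open_content \<phi> V"
  unfolding riesz_outer_def
  by (intro antisym INF_lower INF_greatest) (auto intro: open_content_mono)

lemma riesz_outer_mono: "B \<subseteq> B' \<Longrightarrow> riesz_outer \<phi> B \<le> riesz_outer \<phi> B'"
  unfolding riesz_outer_def by (intro INF_superset_mono) auto

text \<open>Slicing \<open>[0, t]\<close> into unit slabs: the \<open>k\<close>-th summand is the
  length of the part of \<open>[0, t]\<close> between heights \<open>k\<close> and
  \<open>k + 1\<close>. This is the layer-cake decomposition used for the integral formula.\<close>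

lemma sum_clamp: "0 \<le> (t::real) \<Longrightarrow> (\<Sum>k<n. max 0 (min 1 (t - real k))) = min (real n) t"
  by (induction n) auto

text \<open>The sum counts the naturals below both \<open>n\<close> and \<open>t\<close>, and fewer
  than \<open>t + 1\<close> naturals lie below \<open>t\<close>.\<close>

lemma sum_indicator_less: "0 \<le> (t::real) \<Longrightarrow> (\<Sum>k<n. of_bool (real k < t)) \<le> min (real n) (t + 1)"
  by (induction n) auto

context
  fixes \<phi> :: "('g::t2_space \<Rightarrow> real) \<Rightarrow> real"
  assumes compact_UNIV: "compact (UNIV :: 'g set)"
    and pf: "positive_functional \<phi>"
begin

lemma functional_one_nonneg: "0 \<le> \<phi> (\<lambda>x. 1)"
  by (rule positive_functional_nonneg[OF pf]) auto

lemma open_content_UNIV: "open_content \<phi> UNIV = ennreal (\<phi> (\<lambda>x. 1))"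
proof (rule antisym)
  show "open_content \<phi> UNIV \<le> ennreal (\<phi> (\<lambda>x. 1))"
    unfolding open_content_def
    by (intro SUP_least ennreal_leI positive_functional_mono[OF pf]) auto
qed (rule open_content_upper, auto)

lemma open_content_finite: "open_content \<phi> V < \<infinity>"
  using open_content_mono[of V UNIV \<phi>] open_content_UNIV
  by (metis ennreal_less_top infinity_ennreal_def order_le_less_trans top_greatest)

lemma riesz_outer_finite: "riesz_outer \<phi> B < \<infinity>"
proof -
  have "riesz_outer \<phi> B \<le> open_content \<phi> UNIV"
    unfolding riesz_outer_def by (rule INF_lower) auto
  then show ?thesis
    using open_content_finite order_le_less_trans by blast
qed

lemma open_content_empty: "open_content \<phi> {} = 0"
proof -
  have "ennreal (\<phi> f) \<le> 0" if "\<forall>x. 0 \<le> f x \<and> f x \<le> indicator {} x" for f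
  proof -
    have "f = (\<lambda>x. 0)"
      using that by (force intro: antisym)
    then show ?thesis
      by (simp add: positive_functional_zero[OF pf])
  qed
  then have "open_content \<phi> {} \<le> 0"
    unfolding open_content_def by (intro SUP_least) blast
  then show ?thesis by simp
qed

text \<open>\<open>open_content\<close> does not require test functions to be compactly supported in \<open>V\<close>; cutting them
  off at a small height recovers this.\<close>

lemma cutoff:
  assumes f: "continuous_on UNIV f" "\<And>x. 0 \<le> f x" "\<And>x. f x \<le> indicator V x" and "0 < (e::real)"
  obtains f' K where "closed K" "K \<subseteq> V" "continuous_on UNIV f'" "\<And>x. 0 \<le> f' x"
    "\<And>x. f' x \<le> 1" "\<And>x. x \<notin> K \<Longrightarrow> f' x = 0" "\<phi> f \<le> \<phi> f' + e * \<phi> (\<lambda>x. 1)"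
proof (rule that[of "{x. e \<le> f x}" "\<lambda>x. max 0 (f x - e)"])
  show "closed {x. e \<le> f x}"
    using f(1) by (intro closed_Collect_le continuous_intros)
  show "{x. e \<le> f x} \<subseteq> V"
  proof
    fix x assume "x \<in> {x. e \<le> f x}"
    then have "0 < indicat_real V x"
      using f(3)[of x] \<open>0 < e\<close> by simp
    then show "x \<in> V"
      by (simp add: indicator_def split: if_splits)
  qed
  show cont: "continuous_on UNIV (\<lambda>x. max 0 (f x - e))"
    using f(1) by (intro continuous_intros)
  show "max 0 (f x - e) \<le> 1" for x
    using order_trans[OF f(3)[of x] indicator_le_1] \<open>0 < e\<close> by auto
  show "\<phi> f \<le> \<phi> (\<lambda>x. max 0 (f x - e)) + e * \<phi> (\<lambda>x. 1)"
    by (rule positive_functional_le_diff[OF pf f(1) cont]) auto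
qed auto

lemma open_content_approx:
  assumes "0 < e"
  obtains f K where "closed K" "K \<subseteq> V" "continuous_on UNIV f" "\<And>x. 0 \<le> f x"
    "\<And>x. f x \<le> 1" "\<And>x. x \<notin> K \<Longrightarrow> f x = 0" "open_content \<phi> V \<le> ennreal (\<phi> f) + ennreal e"
proof -
  let ?m = "\<phi> (\<lambda>x. 1)"
  obtain f where f: "continuous_on UNIV f" "\<forall>x. 0 \<le> f x \<and> f x \<le> indicator V x"
    and le: "open_content \<phi> V \<le> ennreal (\<phi> f) + ennreal (e/2)"
  proof -
    have "\<exists>f\<in>{f. continuous_on UNIV f \<and> (\<forall>x. 0 \<le> f x \<and> f x \<le> indicator V x)}.
        open_content \<phi> V < ennreal (\<phi> f) + ennreal (e/2)"
    proof (rule SUP_approx_ennreal)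
      show "{f. continuous_on UNIV f \<and> (\<forall>x. 0 \<le> f x \<and> f x \<le> indicat_real V x)} \<noteq> {}"
        by (auto intro!: exI[of _ "\<lambda>x. 0"])
      show "open_content \<phi> V \<noteq> \<infinity>"
        using open_content_finite[of V] by auto
    qed (use assms in \<open>auto simp: open_content_def\<close>)
    then show thesis using that by (auto intro: less_imp_le)
  qed
  \<comment> \<open>Half of \<open>e\<close> is spent on approaching the supremum, the other half on
    the cutoff, which costs \<open>d\<close> times the total mass. The \<open>+ 1\<close> keeps the
    divisor positive when that mass is zero.\<close>
  define d where "d = e / (2 * (?m + 1))"
  have d: "0 < d" "d * ?m \<le> e/2"
    using assms functional_one_nonneg by (auto simp: d_def field_simps)
  obtain f' K where f': "closed K" "K \<subseteq> V" "continuous_on UNIV f'" "\<And>x. 0 \<le> f' x"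
    "\<And>x. f' x \<le> 1" "\<And>x. x \<notin> K \<Longrightarrow> f' x = 0" "\<phi> f \<le> \<phi> f' + d * ?m"
    using cutoff[of f V d] f d by metis
  have nn: "0 \<le> \<phi> f'"
    using f' by (intro positive_functional_nonneg[OF pf]) auto
  have "ennreal (\<phi> f) + ennreal (e/2) \<le> ennreal (\<phi> f' + e/2) + ennreal (e/2)"
    using f'(7) d by (intro add_right_mono ennreal_leI) simp
  also have "\<dots> = ennreal (\<phi> f') + ennreal e"
    using nn assms by (simp flip: ennreal_plus)
  finally show thesis
    using that f' le order_trans by meson
qed

text \<open>A partition of unity: \<open>h\<close> vanishes off \<open>V1\<close> and equals 1 on
  the part of the support \<open>K\<close> outside \<open>V2\<close>, so \<open>f * h\<close> is a
  test function for \<open>V1\<close> and \<open>f * (1 - h)\<close> one for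
  \<open>V2\<close>.\<close>

lemma open_content_Un:
  assumes "open V1" "open V2"
  shows "open_content \<phi> (V1 \<union> V2) \<le> open_content \<phi> V1 + open_content \<phi> V2"
proof (rule ennreal_le_epsilon)
  fix e :: real assume "0 < e"
  then obtain f K where f: "closed K" "K \<subseteq> V1 \<union> V2" "continuous_on UNIV f" "\<And>x. 0 \<le> f x"
    "\<And>x. f x \<le> 1" "\<And>x. x \<notin> K \<Longrightarrow> f x = 0"
    and le: "open_content \<phi> (V1 \<union> V2) \<le> ennreal (\<phi> f) + ennreal e"
    using open_content_approx by metis
  have "closed (- V1)" "closed (K - V2)" "- V1 \<inter> (K - V2) = {}"
    using f(1,2) assms by auto
  then obtain h :: "'g \<Rightarrow> real" where h: "continuous_on UNIV h" "\<And>x. 0 \<le> h x" "\<And>x. h x \<le> 1"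
    "\<And>x. x \<in> - V1 \<Longrightarrow> h x = 0" "\<And>x. x \<in> K - V2 \<Longrightarrow> h x = 1"
    using compact_t2_Urysohn[OF compact_UNIV] by metis
  have c: "continuous_on UNIV (\<lambda>x. f x * h x)" "continuous_on UNIV (\<lambda>x. f x * (1 - h x))"
    using f(3) h(1) by (auto intro!: continuous_intros)
  have "\<phi> f = \<phi> (\<lambda>x. f x * h x + f x * (1 - h x))"
    by (simp add: algebra_simps)
  also have "\<dots> = \<phi> (\<lambda>x. f x * h x) + \<phi> (\<lambda>x. f x * (1 - h x))"
    by (rule positive_functional_add[OF pf c])
  finally have "ennreal (\<phi> f) = ennreal (\<phi> (\<lambda>x. f x * h x)) + ennreal (\<phi> (\<lambda>x. f x * (1 - h x)))"
    using f(4) h(2,3) c by (simp add: ennreal_plus positive_functional_nonneg[OF pf])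
  also have "\<dots> \<le> open_content \<phi> V1 + open_content \<phi> V2"
  proof (intro add_mono open_content_upper c)
    fix x
    show "0 \<le> f x * h x" "0 \<le> f x * (1 - h x)"
      using f(4) h(2,3) by auto
    show "f x * h x \<le> indicator V1 x"
      using f(4,5)[of x] h(2-4)[of x] by (auto simp: indicator_def mult_le_one)
    show "f x * (1 - h x) \<le> indicator V2 x"
      using f(4-6)[of x] h(2,3,5)[of x] by (cases "x \<in> K") (auto simp: indicator_def mult_le_one)
  qed
  finally show "open_content \<phi> (V1 \<union> V2) \<le> open_content \<phi> V1 + open_content \<phi> V2 + ennreal e"
    by (rule order_trans[OF le add_right_mono])
qed

lemma open_content_UN_finite:
  assumes "\<And>i. open (V i)"
  shows "open_content \<phi> (\<Union>i<n::nat. V i) \<le> (\<Sum>i<n. open_content \<phi> (V i))"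
proof (induction n)
  case 0
  then show ?case by (simp add: open_content_empty)
next
  case (Suc n)
  have "open_content \<phi> (\<Union>i<Suc n. V i) = open_content \<phi> ((\<Union>i<n. V i) \<union> V n)"
    by (simp add: lessThan_Suc Un_commute)
  also have "\<dots> \<le> open_content \<phi> (\<Union>i<n. V i) + open_content \<phi> (V n)"
    using assms by (intro open_content_Un) auto
  also have "\<dots> \<le> (\<Sum>i<n. open_content \<phi> (V i)) + open_content \<phi> (V n)"
    by (rule add_right_mono[OF Suc.IH])
  finally show ?case
    by simp
qed

text \<open>A nearly optimal test function lives on a closed, hence compact, \<open>K\<close> inside
  the union. Finitely many of the sets cover \<open>K\<close>, which reduces the claim to finite
  subadditivity.\<close>

lemma open_content_UN:
  fixes V :: "nat \<Rightarrow> 'g set"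
  assumes "\<And>i. open (V i)"
  shows "open_content \<phi> (\<Union>i. V i) \<le> (\<Sum>i. open_content \<phi> (V i))"
proof (rule ennreal_le_epsilon)
  fix e :: real assume "0 < e"
  then obtain f K where f: "closed K" "K \<subseteq> (\<Union>i. V i)" "continuous_on UNIV f" "\<And>x. 0 \<le> f x"
    "\<And>x. f x \<le> 1" "\<And>x. x \<notin> K \<Longrightarrow> f x = 0"
    and le: "open_content \<phi> (\<Union>i. V i) \<le> ennreal (\<phi> f) + ennreal e"
    using open_content_approx by metis
  have "compact K"
    using compact_UNIV f(1) by (metis closed_Int_compact inf_top.right_neutral)
  then obtain C where C: "finite C" "K \<subseteq> (\<Union>i\<in>C. V i)"
    using compactE_image[of K UNIV V] assms f(2) by metis
  obtain n where "C \<subseteq> {..<n}"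
    using C(1) finite_nat_iff_bounded by blast
  then have K: "K \<subseteq> (\<Union>i<n. V i)"
    using C(2) by blast
  have "ennreal (\<phi> f) \<le> open_content \<phi> (\<Union>i<n. V i)"
  proof (rule open_content_upper[OF f(3,4)])
    show "f x \<le> indicator (\<Union>i<n. V i) x" for x
      using f(5,6)[of x] K by (cases "x \<in> K") (auto simp: indicator_def)
  qed
  also have "\<dots> \<le> (\<Sum>i<n. open_content \<phi> (V i))"
    using assms by (rule open_content_UN_finite)
  also have "\<dots> \<le> (\<Sum>i. open_content \<phi> (V i))"
    by (rule sum_le_suminf) auto
  finally show "open_content \<phi> (\<Union>i. V i) \<le> (\<Sum>i. open_content \<phi> (V i)) + ennreal e"
    by (rule order_trans[OF le add_right_mono])
qed

lemma riesz_outer_approx: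
  assumes "0 < e"
  obtains V where "open V" "B \<subseteq> V" "open_content \<phi> V \<le> riesz_outer \<phi> B + ennreal e"
proof -
  have "\<exists>V\<in>{V. open V \<and> B \<subseteq> V}. open_content \<phi> V < riesz_outer \<phi> B + ennreal e"
    by (rule INF_approx_ennreal[OF assms riesz_outer_def]) (use riesz_outer_finite[of B] in auto)
  then show thesis
    using that by (auto intro: less_imp_le)
qed

lemma riesz_outer_UN:
  fixes B :: "nat \<Rightarrow> 'g set"
  shows "riesz_outer \<phi> (\<Union>i. B i) \<le> (\<Sum>i. riesz_outer \<phi> (B i))"
proof (rule ennreal_le_epsilon)
  fix e :: real assume "0 < e"
  then have "\<exists>V. open V \<and> B i \<subseteq> V \<and>
      open_content \<phi> V \<le> riesz_outer \<phi> (B i) + ennreal (e * (1/2) ^ Suc i)" for i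
    using riesz_outer_approx[of "e * (1/2) ^ Suc i" "B i"] by (metis mult_pos_pos zero_less_divide_1_iff
        zero_less_numeral zero_less_power)
  then obtain V where V: "\<And>i. open (V i)" "\<And>i. B i \<subseteq> V i"
    "\<And>i. open_content \<phi> (V i) \<le> riesz_outer \<phi> (B i) + ennreal (e * (1/2) ^ Suc i)"
    by metis
  have s: "(\<lambda>i. e * (1/2) ^ Suc i) sums e"
    using sums_mult[OF power_half_series, of e] by simp
  have "riesz_outer \<phi> (\<Union>i. B i) \<le> riesz_outer \<phi> (\<Union>i. V i)"
    using V(2) by (intro riesz_outer_mono) blast
  also have "\<dots> = open_content \<phi> (\<Union>i. V i)"
    using V(1) by (intro riesz_outer_open) auto
  also have "\<dots> \<le> (\<Sum>i. open_content \<phi> (V i))"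
    using V(1) by (rule open_content_UN)
  also have "\<dots> \<le> (\<Sum>i. riesz_outer \<phi> (B i) + ennreal (e * (1/2) ^ Suc i))"
    using V(3) by (intro suminf_le) auto
  also have "\<dots> = (\<Sum>i. riesz_outer \<phi> (B i)) + (\<Sum>i. ennreal (e * (1/2) ^ Suc i))"
    by (intro suminf_add[symmetric]) auto
  also have "(\<Sum>i. ennreal (e * (1/2) ^ Suc i)) = ennreal e"
    using s \<open>0 < e\<close> by (subst suminf_ennreal_eq[OF _ s]) auto
  finally show "riesz_outer \<phi> (\<Union>i. B i) \<le> (\<Sum>i. riesz_outer \<phi> (B i)) + ennreal e" .
qed

lemma riesz_outer_empty: "riesz_outer \<phi> {} = 0"
  by (simp add: riesz_outer_open open_content_empty)

lemma riesz_outer_Un: "riesz_outer \<phi> (A \<union> B) \<le> riesz_outer \<phi> A + riesz_outer \<phi> B"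
proof -
  have "(\<Sum>i. riesz_outer \<phi> (binaryset A B i)) = riesz_outer \<phi> A + riesz_outer \<phi> B"
    by (intro suminf_binaryset_eq riesz_outer_empty)
  then show ?thesis
    using riesz_outer_UN[of "binaryset A B"] by (simp add: UN_binaryset_eq)
qed

text \<open>Exhaust \<open>U \<inter> V\<close> by \<open>f\<close> supported in \<open>K\<close>,
  and only then exhaust \<open>U - K\<close>, which contains \<open>U - V\<close>, by
  \<open>g\<close>. The supports are disjoint, so \<open>f + g\<close> is still bounded by the
  indicator of \<open>U\<close>.\<close>

lemma open_content_split:
  assumes "open V" "open U"
  shows "riesz_outer \<phi> (U \<inter> V) + riesz_outer \<phi> (U - V) \<le> open_content \<phi> U"
proof (rule ennreal_le_epsilon)
  fix e :: real assume "0 < e"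
  then have "0 < e/2" by simp
  then obtain f K where f: "closed K" "K \<subseteq> U \<inter> V" "continuous_on UNIV f" "\<And>x. 0 \<le> f x"
    "\<And>x. f x \<le> 1" "\<And>x. x \<notin> K \<Longrightarrow> f x = 0"
    and lef: "open_content \<phi> (U \<inter> V) \<le> ennreal (\<phi> f) + ennreal (e/2)"
    using open_content_approx by metis
  obtain g L where g: "closed L" "L \<subseteq> U - K" "continuous_on UNIV g" "\<And>x. 0 \<le> g x"
    "\<And>x. g x \<le> 1" "\<And>x. x \<notin> L \<Longrightarrow> g x = 0"
    and leg: "open_content \<phi> (U - K) \<le> ennreal (\<phi> g) + ennreal (e/2)"
    using open_content_approx \<open>0 < e/2\<close> by metis
  have nn: "0 \<le> \<phi> f" "0 \<le> \<phi> g"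
    using f g by (auto intro!: positive_functional_nonneg[OF pf])
  have "riesz_outer \<phi> (U - V) \<le> riesz_outer \<phi> (U - K)"
    using f(2) by (intro riesz_outer_mono) auto
  also have "\<dots> = open_content \<phi> (U - K)"
    using assms f(1) by (intro riesz_outer_open) auto
  finally have "riesz_outer \<phi> (U \<inter> V) + riesz_outer \<phi> (U - V)
      \<le> (ennreal (\<phi> f) + ennreal (e/2)) + (ennreal (\<phi> g) + ennreal (e/2))"
    using lef leg assms by (intro add_mono) (auto simp: riesz_outer_open open_Int)
  also have "\<dots> = ennreal (\<phi> f + \<phi> g) + ennreal e"
    using nn \<open>0 < e\<close> by (simp flip: ennreal_plus)
  also have "\<phi> f + \<phi> g = \<phi> (\<lambda>x. f x + g x)"
    using f g by (simp add: positive_functional_add[OF pf])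
  also have "ennreal (\<phi> (\<lambda>x. f x + g x)) \<le> open_content \<phi> U"
  proof (rule open_content_upper)
    show "continuous_on UNIV (\<lambda>x. f x + g x)"
      using f g by (intro continuous_intros)
    show "0 \<le> f x + g x" for x
      using f(4) g(4) by simp
    show "f x + g x \<le> indicator U x" for x
      using f(2) f(5,6)[of x] g(2) g(5,6)[of x]
      by (cases "x \<in> K"; cases "x \<in> L") (auto simp: indicator_def)
  qed
  finally show "riesz_outer \<phi> (U \<inter> V) + riesz_outer \<phi> (U - V) \<le> open_content \<phi> U + ennreal e"
    by (simp add: add_right_mono)
qed

lemma riesz_outer_split:
  assumes "open V"
  shows "riesz_outer \<phi> (E \<inter> V) + riesz_outer \<phi> (E - V) = riesz_outer \<phi> E"
proof (rule antisym)
  show "riesz_outer \<phi> E \<le> riesz_outer \<phi> (E \<inter> V) + riesz_outer \<phi> (E - V)"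
    using riesz_outer_Un[of "E \<inter> V" "E - V"] by (simp add: Int_Diff_Un)
  have "riesz_outer \<phi> (E \<inter> V) + riesz_outer \<phi> (E - V) \<le> open_content \<phi> U"
    if "open U" "E \<subseteq> U" for U
    by (rule order_trans[OF add_mono open_content_split[OF assms \<open>open U\<close>]])
       (use that in \<open>auto intro: riesz_outer_mono\<close>)
  then show "riesz_outer \<phi> (E \<inter> V) + riesz_outer \<phi> (E - V) \<le> riesz_outer \<phi> E"
    unfolding riesz_outer_def[of \<phi> E] by (intro INF_greatest) auto
qed

text \<open>Caratheodory's construction: the outer measure is a measure on its measurable sets. By
  \<open>riesz_outer_split\<close> these include the open sets, hence all Borel sets.\<close>

lemma measure_space_riesz: "measure_space UNIV (sets borel) (riesz_outer \<phi>)"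
proof -
  interpret P: sigma_algebra UNIV "Pow UNIV :: 'g set set"
    by (rule sigma_algebra_Pow)
  let ?L = "lambda_system UNIV (Pow UNIV) (riesz_outer \<phi>)"
  have "outer_measure_space (Pow UNIV) (riesz_outer \<phi>)"
    using riesz_outer_empty riesz_outer_UN
    by (auto simp: outer_measure_space_def positive_def increasing_def countably_subadditive_def
        intro: riesz_outer_mono)
  then have L: "measure_space UNIV ?L (riesz_outer \<phi>)"
    by (rule P.caratheodory_lemma)
  then interpret L: sigma_algebra UNIV ?L
    by (simp add: measure_space_def)
  have "V \<in> ?L" if "open V" for V
    using riesz_outer_split[OF that] unfolding P.lambda_system_eq by blast
  then have "sets borel \<subseteq> ?L"
    unfolding sets_borel by (intro L.sigma_sets_subset) auto
  then show ?thesis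
    using measure_down[OF L] sets.sigma_algebra_axioms[of "borel :: 'g measure"] by simp
qed

section \<open>The Riesz measure on Borel sets: values, finiteness and regularity\<close>

lemma sets_riesz_measure [simp]: "sets (riesz_measure \<phi>) = sets borel"
  by (metis measure_space_riesz riesz_measure_def sets.sigma_sets_eq sets_measure_of
      space_borel sets.space_closed)

lemma space_riesz_measure [simp]: "space (riesz_measure \<phi>) = UNIV"
  using sets_eq_imp_space_eq[OF sets_riesz_measure] by simp

lemma emeasure_riesz_measure:
  assumes "B \<in> sets borel"
  shows "emeasure (riesz_measure \<phi>) B = riesz_outer \<phi> B"
  using measure_space_riesz assms unfolding riesz_measure_def
  by (intro emeasure_measure_of_sigma) (auto simp: measure_space_def)

lemma emeasure_riesz_measure_open:
  "open V \<Longrightarrow> emeasure (riesz_measure \<phi>) V = open_content \<phi> V"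
  by (simp add: emeasure_riesz_measure riesz_outer_open)

lemma finite_measure_riesz: "finite_measure (riesz_measure \<phi>)"
  using open_content_finite[of UNIV]
  by (intro finite_measureI) (simp add: emeasure_riesz_measure_open less_top)

text \<open>Inner regularity of \<open>B\<close> is outer regularity of its complement: if an open
  \<open>V\<close> contains \<open>- B\<close> with excess mass at most \<open>e\<close>, then
  \<open>- V\<close> is a compact subset of \<open>B\<close> missing at most mass
  \<open>e\<close>.\<close>

lemma radon_riesz_measure: "radon (riesz_measure \<phi>)"
  unfolding radon_def
proof (intro conjI ballI sets_riesz_measure)
  interpret finite_measure "riesz_measure \<phi>" by (rule finite_measure_riesz)
  show "emeasure (riesz_measure \<phi>) (space (riesz_measure \<phi>)) < \<infinity>"
    by (simp add: less_top[symmetric])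
  fix B :: "'g set" assume B: "B \<in> sets borel"
  show "emeasure (riesz_measure \<phi>) B = (SUP K\<in>{K. K \<subseteq> B \<and> compact K}. emeasure (riesz_measure \<phi>) K)"
  proof (rule antisym)
    show "emeasure (riesz_measure \<phi>) B \<le> (SUP K\<in>{K. K \<subseteq> B \<and> compact K}. emeasure (riesz_measure \<phi>) K)"
    proof (rule ennreal_le_epsilon)
      fix e :: real assume "0 < e"
      then obtain V where V: "open V" "- B \<subseteq> V"
        "open_content \<phi> V \<le> riesz_outer \<phi> (- B) + ennreal e"
        using riesz_outer_approx by metis
      have VB: "V \<in> sets (riesz_measure \<phi>)" "B \<in> sets (riesz_measure \<phi>)"
        using V B by auto
      have "emeasure (riesz_measure \<phi>) V \<le> emeasure (riesz_measure \<phi>) (- B) + ennreal e"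
        using V B by (simp add: emeasure_riesz_measure riesz_outer_open)
      then have "measure (riesz_measure \<phi>) V \<le> measure (riesz_measure \<phi>) (- B) + e"
        using \<open>0 < e\<close> by (simp add: emeasure_eq_measure flip: ennreal_plus)
      moreover have "measure (riesz_measure \<phi>) (- B) = measure (riesz_measure \<phi>) UNIV - measure (riesz_measure \<phi>) B"
        "measure (riesz_measure \<phi>) (- V) = measure (riesz_measure \<phi>) UNIV - measure (riesz_measure \<phi>) V"
        using finite_measure_compl[OF VB(1)] finite_measure_compl[OF VB(2)]
        by (simp_all add: Compl_eq_Diff_UNIV)
      ultimately have "measure (riesz_measure \<phi>) B \<le> measure (riesz_measure \<phi>) (- V) + e"
        by linarith
      then have "emeasure (riesz_measure \<phi>) B \<le> emeasure (riesz_measure \<phi>) (- V) + ennreal e"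
        using \<open>0 < e\<close> by (simp add: emeasure_eq_measure flip: ennreal_plus del: diff_ge_0_iff_ge)
      moreover have "compact (- V)"
        using V(1) compact_UNIV by (metis closed_Compl closed_Int_compact inf_top.right_neutral)
      then have "emeasure (riesz_measure \<phi>) (- V) \<le> (SUP K\<in>{K. K \<subseteq> B \<and> compact K}. emeasure (riesz_measure \<phi>) K)"
        using V(2) by (intro SUP_upper) auto
      ultimately show "emeasure (riesz_measure \<phi>) B
          \<le> (SUP K\<in>{K. K \<subseteq> B \<and> compact K}. emeasure (riesz_measure \<phi>) K) + ennreal e"
        using add_right_mono order_trans by blast
    qed
  qed (use B in \<open>auto intro!: SUP_least emeasure_mono\<close>)
qed

section \<open>The functional as integration against its Riesz measure\<close>

lemma functional_le_riesz_integral_unit: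
  assumes f: "continuous_on UNIV f" "\<And>x. 0 \<le> f x" "\<And>x. f x \<le> 1"
  shows "\<phi> f \<le> integral\<^sup>L (riesz_measure \<phi>) f"
proof -
  interpret finite_measure "riesz_measure \<phi>" by (rule finite_measure_riesz)
  let ?M = "riesz_measure \<phi>"
  have meas: "f \<in> borel_measurable ?M"
    using borel_measurable_continuous_onI[OF f(1)] by (simp cong: measurable_cong_sets)
  have int: "integrable ?M f"
    using f by (intro integrable_const_bound[of _ 1] meas) auto
  \<comment> \<open>Layer cake: \<open>n * f\<close> is the sum of the slabs \<open>F k\<close>, and
    \<open>F k\<close> is a test function for the level set \<open>V k\<close>. At most
    \<open>n * f x + 1\<close> level sets contain \<open>x\<close>, so the total error is one full
    mass, independent of \<open>n\<close>, and disappears after division by large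
    \<open>n\<close>.\<close>
  have bound: "real n * \<phi> f \<le> real n * integral\<^sup>L ?M f + measure ?M UNIV" for n :: nat
  proof -
    define F where "F k x = max 0 (min 1 (real n * f x - real k))" for k x
    define V where "V k = {x. real k < real n * f x}" for k
    have F: "continuous_on UNIV (F k)" for k
      unfolding F_def using f(1) by (intro continuous_intros)
    have V: "open (V k)" for k
      unfolding V_def using f(1) by (intro open_Collect_less continuous_intros)
    have le: "\<phi> (F k) \<le> measure ?M (V k)" for k
    proof -
      have "ennreal (\<phi> (F k)) \<le> open_content \<phi> (V k)"
        by (rule open_content_upper[OF F]) (auto simp: F_def V_def indicator_def)
      then show ?thesis
        by (metis V emeasure_riesz_measure_open emeasure_eq_measure ennreal_le_iff measure_nonneg)
    qed
    have "real n * f x = (\<Sum>k<n. F k x)" for x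
      using f(2,3)[of x] sum_clamp[of "real n * f x" n] mult_left_mono[OF f(3)[of x], of "real n"]
      by (simp add: F_def)
    then have "real n * \<phi> f = \<phi> (\<lambda>x. \<Sum>k<n. F k x)"
      using positive_functional_scale[OF pf f(1), of "real n"] by simp
    also have "\<dots> = (\<Sum>k<n. \<phi> (F k))"
      by (rule positive_functional_sum[OF pf]) (auto intro: F)
    also have "\<dots> \<le> (\<Sum>k<n. measure ?M (V k))"
      by (intro sum_mono le)
    also have "\<dots> = (\<Sum>k<n. integral\<^sup>L ?M (indicator (V k)))"
      using V by simp
    also have "\<dots> = integral\<^sup>L ?M (\<lambda>x. \<Sum>k<n. indicator (V k) x)"
      using V by (intro Bochner_Integration.integral_sum[symmetric])
        (auto simp: less_top[symmetric] emeasure_eq_measure)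
    also have "\<dots> \<le> integral\<^sup>L ?M (\<lambda>x. real n * f x + 1)"
    proof (rule integral_mono)
      show "integrable ?M (\<lambda>x. \<Sum>k<n. indicat_real (V k) x)"
        using V by (intro Bochner_Integration.integrable_sum)
          (auto simp: less_top[symmetric] emeasure_eq_measure)
      show "integrable ?M (\<lambda>x. real n * f x + 1)"
        using int by simp
      show "(\<Sum>k<n. indicat_real (V k) x) \<le> real n * f x + 1" for x
        using sum_indicator_less[of "real n * f x" n] f(2)[of x]
        by (simp add: V_def indicator_def)
    qed
    also have "\<dots> = real n * integral\<^sup>L ?M f + measure ?M UNIV"
      using int by simp
    finally show ?thesis .
  qed
  show ?thesis
  proof (rule ccontr)
    assume "\<not> ?thesis"
    then have "0 < \<phi> f - integral\<^sup>L ?M f" by simp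
    then obtain n :: nat where "measure ?M UNIV < real n * (\<phi> f - integral\<^sup>L ?M f)"
      using ex_less_of_nat_mult by blast
    with bound[of n] show False by (simp add: algebra_simps)
  qed
qed

lemma measure_riesz_UNIV: "measure (riesz_measure \<phi>) UNIV = \<phi> (\<lambda>x. 1)"
  using functional_one_nonneg by (simp add: measure_def emeasure_riesz_measure_open open_content_UNIV)

text \<open>An affine change maps \<open>f\<close> to \<open>u\<close> with values in
  \<open>[0, 1]\<close>. The one-sided bound applied to both \<open>u\<close> and
  \<open>1 - u\<close> gives equality, since functional and measure have the same total
  mass.\<close>

theorem integral_riesz_measure:
  assumes f: "continuous_on UNIV f"
  shows "integral\<^sup>L (riesz_measure \<phi>) f = \<phi> f"
proof -
  interpret finite_measure "riesz_measure \<phi>" by (rule finite_measure_riesz)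
  let ?M = "riesz_measure \<phi>"
  have "bounded (range f)"
    using compact_continuous_image[OF f compact_UNIV] by (rule compact_imp_bounded)
  then obtain C0 where "\<forall>x. \<bar>f x\<bar> \<le> C0"
    by (auto simp: bounded_iff)
  then obtain C where C: "\<And>x. \<bar>f x\<bar> \<le> C" "0 < C"
    by (metis abs_ge_zero add.commute add_pos_nonneg le_add_same_cancel2 less_eq_real_def order_trans zero_less_one)
  have meas: "f \<in> borel_measurable ?M"
    using borel_measurable_continuous_onI[OF f(1)] by (simp cong: measurable_cong_sets)
  have int: "integrable ?M f"
    using C by (intro integrable_const_bound[of _ C] meas) auto
  define u where "u x = (f x + C) / (2 * C)" for x
  have u: "continuous_on UNIV u" "0 \<le> u x" "u x \<le> 1" for x
    unfolding u_def using f C(2) C(1)[of x] by (auto intro!: continuous_intros simp: field_simps)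
  have intu: "integrable ?M u"
    unfolding u_def using int by simp
  have "\<phi> u \<le> integral\<^sup>L ?M u"
    by (rule functional_le_riesz_integral_unit[OF u])
  moreover have "\<phi> (\<lambda>x. 1 - u x) \<le> integral\<^sup>L ?M (\<lambda>x. 1 - u x)"
    using u by (intro functional_le_riesz_integral_unit continuous_intros) auto
  then have "\<phi> (\<lambda>x. 1) - \<phi> u \<le> measure ?M UNIV - integral\<^sup>L ?M u"
    using u intu positive_functional_diff[OF pf continuous_on_const u(1)] by simp
  ultimately have eq: "\<phi> u = integral\<^sup>L ?M u"
    by (simp add: measure_riesz_UNIV)
  have "f = (\<lambda>x. 2 * C * u x - C)"
    using C(2) by (auto simp: u_def)
  moreover have "\<phi> (\<lambda>x. 2 * C * u x - C) = 2 * C * \<phi> u - C * \<phi> (\<lambda>x. 1)"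
    using positive_functional_diff[OF pf _ continuous_on_const, of "\<lambda>x. 2 * C * u x" C] u(1)
      positive_functional_scale[OF pf u(1), of "2 * C"] positive_functional_const[OF pf, of C]
    by (simp add: continuous_intros)
  moreover have "integral\<^sup>L ?M (\<lambda>x. 2 * C * u x - C) = 2 * C * integral\<^sup>L ?M u - C * measure ?M UNIV"
    using intu by simp
  ultimately show ?thesis
    using eq by (simp add: measure_riesz_UNIV)
qed

section \<open>Support and invariance of the Riesz measure\<close>

lemma riesz_measure_support:
  assumes "open V" "\<And>f. continuous_on UNIV f \<Longrightarrow> (\<And>x. x \<notin> V \<Longrightarrow> f x = 0) \<Longrightarrow> \<phi> f = 0"
  shows "emeasure (riesz_measure \<phi>) V = 0"
proof -
  have "\<phi> f = 0" if "continuous_on UNIV f" "\<forall>x. 0 \<le> f x \<and> f x \<le> indicat_real V x" for f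
  proof (rule assms(2)[OF that(1)])
    show "f x = 0" if "x \<notin> V" for x
      using \<open>\<forall>x. 0 \<le> f x \<and> f x \<le> indicat_real V x\<close>[rule_format, of x] that by simp
  qed
  then have "open_content \<phi> V \<le> 0"
    unfolding open_content_def by (intro SUP_least) auto
  then show ?thesis
    by (simp add: emeasure_riesz_measure_open assms(1))
qed

text \<open>Composing with \<open>t\<close> and with its inverse \<open>s\<close> exchanges the test
  functions of \<open>V\<close> and of its preimage, so both measures agree on open sets. These form
  an intersection-stable generator, and the measures are finite.\<close>

lemma distr_riesz_measure:
  assumes t: "continuous_on UNIV t" "continuous_on UNIV s" "\<And>x. t (s x) = x" "\<And>x. s (t x) = x"
    and inv: "\<And>f. continuous_on UNIV f \<Longrightarrow> \<phi> (\<lambda>x. f (t x)) = \<phi> f"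
  shows "distr (riesz_measure \<phi>) borel t = riesz_measure \<phi>"
proof -
  interpret finite_measure "riesz_measure \<phi>" by (rule finite_measure_riesz)
  have meas: "t \<in> measurable (riesz_measure \<phi>) borel"
    using borel_measurable_continuous_onI[OF t(1)] by (simp cong: measurable_cong_sets)
  have emeasure_eq: "emeasure (distr (riesz_measure \<phi>) borel t) V = emeasure (riesz_measure \<phi>) V" if "open V" for V
  proof -
    have [simp]: "open (t -` V)"
      using t(1) that by (simp add: open_vimage)
    have "open_content \<phi> (t -` V) = open_content \<phi> V"
    proof (rule antisym)
      show "open_content \<phi> (t -` V) \<le> open_content \<phi> V"
        unfolding open_content_def[of _ "t -` V"]
      proof (intro SUP_least)
        fix f assume "f \<in> {f. continuous_on UNIV f \<and> (\<forall>x. 0 \<le> f x \<and> f x \<le> indicat_real (t -` V) x)}"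
        then have f: "continuous_on UNIV f" "\<And>x. 0 \<le> f x" "\<And>x. f x \<le> indicat_real (t -` V) x"
          by auto
        have c: "continuous_on UNIV (\<lambda>x. f (s x))"
          using continuous_on_compose2[OF f(1) t(2)] by simp
        have "\<phi> f = \<phi> (\<lambda>x. f (s x))"
          using inv[OF c] t(4) by simp
        also have "ennreal (\<phi> (\<lambda>x. f (s x))) \<le> open_content \<phi> V"
        proof (rule open_content_upper[OF c])
          show "f (s x) \<le> indicator V x" for x
            using f(3)[of "s x"] t(3) by (simp add: indicator_def)
        qed (rule f(2))
        finally show "ennreal (\<phi> f) \<le> open_content \<phi> V" .
      qed
      show "open_content \<phi> V \<le> open_content \<phi> (t -` V)"
        unfolding open_content_def[of _ V]
      proof (intro SUP_least)
        fix f assume "f \<in> {f. continuous_on UNIV f \<and> (\<forall>x. 0 \<le> f x \<and> f x \<le> indicat_real V x)}"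
        then have f: "continuous_on UNIV f" "\<And>x. 0 \<le> f x" "\<And>x. f x \<le> indicat_real V x"
          by auto
        have c: "continuous_on UNIV (\<lambda>x. f (t x))"
          using continuous_on_compose2[OF f(1) t(1)] by simp
        have "ennreal (\<phi> (\<lambda>x. f (t x))) \<le> open_content \<phi> (t -` V)"
        proof (rule open_content_upper[OF c])
          show "f (t x) \<le> indicator (t -` V) x" for x
            using f(3)[of "t x"] by (simp add: indicator_def)
        qed (rule f(2))
        then show "ennreal (\<phi> f) \<le> open_content \<phi> (t -` V)"
          using inv[OF f(1)] by simp
      qed
    qed
    then show ?thesis
      using meas that by (simp add: emeasure_distr emeasure_riesz_measure_open)
  qed
  show ?thesis
  proof (rule measure_eqI_generator_eq[where E = "{V. open V}" and \<Omega> = UNIV and A = "\<lambda>_. UNIV"])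
    show "Int_stable {V :: 'g set. open V}"
      by (auto simp: Int_stable_def)
  qed (auto simp: emeasure_eq sets_borel emeasure_eq_measure)
qed

end

subsection \<open>Averaging over finite nets of a subgroup\<close>

lemma compact_group_compact: "compact_group TYPE('g::{group_add,t2_space}) \<Longrightarrow> compact (UNIV :: 'g set)"
  by (simp add: compact_group_def)

lemma continuous_on_group_add:
  fixes f g :: "'a::topological_space \<Rightarrow> 'g::{group_add,t2_space}"
  assumes "compact_group TYPE('g)" "continuous_on S f" "continuous_on S g"
  shows "continuous_on S (\<lambda>x. f x + g x)"
proof -
  have "continuous_on UNIV (\<lambda>p::'g \<times> 'g. fst p + snd p)"
    using assms(1) by (simp add: compact_group_def)
  from continuous_on_compose2[OF this continuous_on_Pair[OF assms(2,3)]] show ?thesis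
    by simp
qed

lemma continuous_on_group_uminus:
  fixes f :: "'a::topological_space \<Rightarrow> 'g::{group_add,t2_space}"
  assumes "compact_group TYPE('g)" "continuous_on S f"
  shows "continuous_on S (\<lambda>x. - f x)"
proof -
  have "continuous_on UNIV (uminus :: 'g \<Rightarrow> 'g)"
    using assms(1) by (simp add: compact_group_def)
  from continuous_on_compose2[OF this assms(2)] show ?thesis
    by simp
qed

lemma continuous_on_group_diff:
  fixes f g :: "'a::topological_space \<Rightarrow> 'g::{group_add,t2_space}"
  assumes "compact_group TYPE('g)" "continuous_on S f" "continuous_on S g"
  shows "continuous_on S (\<lambda>x. f x - g x)"
  using continuous_on_group_add[OF assms(1,2) continuous_on_group_uminus[OF assms(1,3)]] by simp

lemma continuous_on_translate:
  fixes f :: "'g::{group_add,t2_space} \<Rightarrow> 'b::topological_space"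
  assumes "compact_group TYPE('g)" "continuous_on UNIV f"
  shows "continuous_on UNIV (\<lambda>g. f (x + g - y))" "continuous_on UNIV (\<lambda>g. f (x + g))"
    "continuous_on UNIV (\<lambda>g. f (g - y))"
  by (rule continuous_on_compose2[OF assms(2)];
      simp add: continuous_on_group_diff[OF assms(1)] continuous_on_group_add[OF assms(1)])+

text \<open>The direction from the translate back to \<open>f\<close> serves discontinuous
  \<open>f\<close>: a functional that is 0 on discontinuous functions keeps this property under
  averaging of translates.\<close>

lemma continuous_on_translate_iff:
  fixes f :: "'g::{group_add,t2_space} \<Rightarrow> 'b::topological_space"
  assumes "compact_group TYPE('g)"
  shows "continuous_on UNIV (\<lambda>g. f (x + g - y)) \<longleftrightarrow> continuous_on UNIV f"
proof
  assume "continuous_on UNIV (\<lambda>g. f (x + g - y))"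
  from continuous_on_translate(1)[OF assms this, of "- x" "- y"] show "continuous_on UNIV f"
    by (simp add: add.assoc diff_conv_add_uminus del: add_uminus_conv_diff)
qed (rule continuous_on_translate[OF assms])

section \<open>Two-sided uniform continuity and finite nets\<close>

definition bi_modulus :: "'g::group_add set \<Rightarrow> real \<Rightarrow> ('g \<Rightarrow> real) \<Rightarrow> bool" where
  "bi_modulus U e f \<longleftrightarrow> (\<forall>a b. \<forall>u\<in>U. \<bar>f (a + u + b) - f (a + b)\<bar> \<le> e)"

text \<open>The increment \<open>D\<close> is continuous in \<open>(u, a, b)\<close> and vanishes at
  \<open>u = 0\<close>. As the range of \<open>(a, b)\<close> is compact, the tube lemma gives one
  neighbourhood \<open>U\<close> for all \<open>a\<close> and \<open>b\<close>.\<close>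

lemma bi_modulus_exists:
  fixes f :: "'g::{group_add,t2_space} \<Rightarrow> real"
  assumes cg: "compact_group TYPE('g)" and f: "continuous_on UNIV f" and "0 < e"
  obtains U where "open U" "0 \<in> U" "bi_modulus U e f"
proof -
  define D where "D p = \<bar>f (fst (snd p) + fst p + snd (snd p)) - f (fst (snd p) + snd (snd p))\<bar>"
    for p :: "'g \<times> 'g \<times> 'g"
  have "continuous_on UNIV D"
    unfolding D_def
    by (intro continuous_intros continuous_on_compose2[OF f] continuous_on_group_add[OF cg]) auto
  then have "open {p. D p < e}"
    by (intro open_Collect_less continuous_intros)
  moreover have "compact (UNIV :: ('g \<times> 'g) set)"
    using compact_Times[OF compact_group_compact[OF cg] compact_group_compact[OF cg]] by simp
  moreover have "{0} \<times> UNIV \<subseteq> {p. D p < e}"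
    using \<open>0 < e\<close> by (auto simp: D_def)
  ultimately obtain U where U: "0 \<in> U" "open U" "U \<times> UNIV \<subseteq> {p. D p < e}"
    using Elementary_Topology.tube_lemma by metis
  have "bi_modulus U e f"
    unfolding bi_modulus_def
  proof (intro allI ballI)
    fix a b u assume "u \<in> U"
    then have "(u, a, b) \<in> {p. D p < e}"
      using U(3) by blast
    then show "\<bar>f (a + u + b) - f (a + b)\<bar> \<le> e"
      by (simp add: D_def)
  qed
  then show thesis
    using that U by blast
qed

text \<open>Having the increment \<open>u\<close> in the middle makes the modulus stable under
  translation from both sides in a noncommutative group: \<open>x\<close> is absorbed into
  \<open>a\<close> and \<open>y\<close> into \<open>b\<close>.\<close>

lemma bi_modulus_translate:
  assumes "bi_modulus U e f"
  shows "bi_modulus U e (\<lambda>g. f (x + g - y))"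
  unfolding bi_modulus_def
proof (intro allI ballI)
  fix a b u assume "u \<in> U"
  then have "\<bar>f ((x + a) + u + (b - y)) - f ((x + a) + (b - y))\<bar> \<le> e"
    using assms by (simp add: bi_modulus_def)
  then show "\<bar>f (x + (a + u + b) - y) - f (x + (a + b) - y)\<bar> \<le> e"
    by (simp add: add.assoc diff_conv_add_uminus del: add_uminus_conv_diff)
qed

text \<open>The sets of \<open>t\<close> with \<open>- t + y \<in> U\<close>, for
  \<open>y \<in> W\<close>, are open and cover the compact \<open>W\<close>, because
  \<open>t\<close> lies in its own set. A finite subcover says that each \<open>t\<close> satisfies
  \<open>y = t + u\<close> for some net point \<open>y\<close> and some
  \<open>u \<in> U\<close>.\<close>

lemma subgroup_finite_net:
  fixes W U :: "'g::{group_add,t2_space} set"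
  assumes cg: "compact_group TYPE('g)" and W: "closed W" "0 \<in> W" and U: "open U" "0 \<in> U"
  obtains Y where "finite Y" "Y \<subseteq> W" "Y \<noteq> {}" "\<And>t. t \<in> W \<Longrightarrow> \<exists>y\<in>Y. - t + y \<in> U"
proof -
  have "compact W"
    using W(1) compact_group_compact[OF cg] by (metis closed_Int_compact inf_top.right_neutral)
  moreover have "open ((\<lambda>t. - t + y) -` U)" for y
    by (intro open_vimage U continuous_on_group_add[OF cg] continuous_on_group_uminus[OF cg]
        continuous_on_const continuous_on_id)
  moreover have "W \<subseteq> (\<Union>y\<in>W. (\<lambda>t. - t + y) -` U)"
    using U(2) by auto
  ultimately obtain Y where Y: "Y \<subseteq> W" "finite Y" "W \<subseteq> (\<Union>y\<in>Y. (\<lambda>t. - t + y) -` U)"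
    using compactE_image[of W W "\<lambda>y. (\<lambda>t. - t + y) -` U"] by metis
  show thesis
  proof (rule that[OF Y(2,1)])
    show "Y \<noteq> {}"
      using Y(3) W(2) by auto
    show "\<exists>y\<in>Y. - t + y \<in> U" if "t \<in> W" for t
      using Y(3) that by auto
  qed
qed

section \<open>Contraction of the oscillation under averaging\<close>

lemma average_contraction:
  fixes H :: "'g::group_add \<Rightarrow> real"
  assumes Y: "finite Y" "Y \<subseteq> W" "Y \<noteq> {}" and W: "\<And>x y. x \<in> W \<Longrightarrow> y \<in> W \<Longrightarrow> x + y \<in> W"
    and osc: "\<And>z z'. z \<in> W \<Longrightarrow> z' \<in> W \<Longrightarrow> H z - H z' \<le> d"
    and net: "\<And>z z'. z \<in> W \<Longrightarrow> z' \<in> W \<Longrightarrow> \<exists>y\<in>Y. H (z + y) \<le> H z' + e"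
    and z: "z \<in> W" "z' \<in> W"
  shows "(\<Sum>y\<in>Y. H (z + y)) - (\<Sum>y\<in>Y. H (z' + y)) \<le> (real (card Y) - 1) * d + e"
proof -
  \<comment> \<open>The pivot is \<open>a\<close>, the least term of the \<open>z'\<close> sum, so
    that sum is at least \<open>card Y * a\<close>. In the \<open>z\<close> sum the net supplies one
    term within \<open>e\<close> of \<open>a\<close>, and the other \<open>card Y - 1\<close> terms
    exceed \<open>a\<close> by at most \<open>d\<close>.\<close>
  obtain y1 where y1: "y1 \<in> Y" "\<And>y. y \<in> Y \<Longrightarrow> H (z' + y1) \<le> H (z' + y)"
    using arg_min_if_finite[of Y "\<lambda>y. H (z' + y)"] Y by (meson not_le)
  define a where "a = H (z' + y1)"
  have "z' + y1 \<in> W"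
    using y1 Y W z by auto
  then obtain y0 where y0: "y0 \<in> Y" "H (z + y0) \<le> a + e"
    using net z unfolding a_def by metis
  have "(\<Sum>y\<in>Y. H (z + y)) = H (z + y0) + (\<Sum>y\<in>Y - {y0}. H (z + y))"
    using Y y0 by (intro sum.remove) auto
  also have "\<dots> \<le> (a + e) + (\<Sum>y\<in>Y - {y0}. a + d)"
  proof (intro add_mono sum_mono y0(2))
    fix y assume "y \<in> Y - {y0}"
    then have "H (z + y) - H (z' + y1) \<le> d"
      using Y W z by (intro osc \<open>z' + y1 \<in> W\<close>) auto
    then show "H (z + y) \<le> a + d"
      by (simp add: a_def)
  qed
  also have "\<dots> = (a + e) + (real (card Y) - 1) * (a + d)"
  proof -
    have "real (card (Y - {y0})) = real (card Y) - 1"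
      using Y y0 card_gt_0_iff[of Y] by (simp add: card_Diff_singleton of_nat_diff)
    then show ?thesis by simp
  qed
  also have "\<dots> = real (card Y) * a + (real (card Y) - 1) * d + e"
    by (simp add: algebra_simps)
  finally show ?thesis
    using sum_bounded_below[of Y a "\<lambda>y. H (z' + y)"] y1(2) by (simp add: a_def)
qed

text \<open>For integration against \<open>\<mu>\<close> this is integration against
  \<open>p * \<mu> * p*\<close>, with \<open>p\<close> uniform on \<open>Y\<close>: left
  translations by \<open>x\<close> and right translations by \<open>- y\<close>.\<close>

definition average :: "'g::group_add set \<Rightarrow> (('g \<Rightarrow> real) \<Rightarrow> real) \<Rightarrow> ('g \<Rightarrow> real) \<Rightarrow> real" where
  "average Y \<phi> f = (\<Sum>x\<in>Y. \<Sum>y\<in>Y. \<phi> (\<lambda>g. f (x + g - y))) / (real (card Y))\<^sup>2"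

text \<open>The class is closed under two-sided translation, so an oscillation bound that is uniform
  over it also covers every translate occurring in an average and can be iterated.\<close>

definition equi_class :: "'g::{group_add,topological_space} set \<Rightarrow> real \<Rightarrow> real \<Rightarrow> ('g \<Rightarrow> real) set" where
  "equi_class U e C = {f. continuous_on UNIV f \<and> bi_modulus U e f \<and> (\<forall>x. \<bar>f x\<bar> \<le> C)}"

lemma equi_class_translate:
  fixes f :: "'g::{group_add,t2_space} \<Rightarrow> real"
  assumes "compact_group TYPE('g)" "f \<in> equi_class U e C"
  shows "(\<lambda>g. f (x + g - y)) \<in> equi_class U e C"
  using assms by (simp add: equi_class_def continuous_on_translate bi_modulus_translate)

definition osc_bound ::
  "'g::{group_add,topological_space} set \<Rightarrow> ('g \<Rightarrow> real) set \<Rightarrow> (('g \<Rightarrow> real) \<Rightarrow> real) \<Rightarrow> real \<Rightarrow> bool" where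
  "osc_bound W E \<phi> d \<longleftrightarrow> (\<forall>f\<in>E. \<forall>z\<in>W. \<forall>z'\<in>W.
     \<phi> (\<lambda>g. f (z + g)) - \<phi> (\<lambda>g. f (z' + g)) \<le> d \<and>
     \<phi> (\<lambda>g. f (g - z)) - \<phi> (\<lambda>g. f (g - z')) \<le> d)"

text \<open>Translation by \<open>z\<close> acts on one of the two averaging variables only. With
  the other variable fixed, \<open>average_contraction\<close> bounds the inner sum, with error
  \<open>e\<close> times the mass; summing over the fixed variable and dividing by the square of
  \<open>card Y\<close> gives the new bound.\<close>

lemma osc_bound_average:
  fixes \<phi> :: "('g::{group_add,t2_space} \<Rightarrow> real) \<Rightarrow> real"
  assumes cg: "compact_group TYPE('g)" and pf: "positive_functional \<phi>"
    and Y: "finite Y" "Y \<subseteq> W" "Y \<noteq> {}"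
    and W: "\<And>x y. x \<in> W \<Longrightarrow> y \<in> W \<Longrightarrow> x + y \<in> W" "\<And>x. x \<in> W \<Longrightarrow> - x \<in> W"
    and net: "\<And>t. t \<in> W \<Longrightarrow> \<exists>y\<in>Y. - t + y \<in> U"
    and osc: "osc_bound W (equi_class U e C) \<phi> d"
  shows "osc_bound W (equi_class U e C) (average Y \<phi>)
    ((1 - 1 / real (card Y)) * d + e * \<phi> (\<lambda>x. 1) / real (card Y))"
  unfolding osc_bound_def
proof (intro ballI conjI)
  fix f z z' assume f: "f \<in> equi_class U e C" and z: "z \<in> W" "z' \<in> W"
  let ?N = "real (card Y)" and ?m = "\<phi> (\<lambda>x. 1)"
  have N: "0 < ?N"
    using Y card_gt_0_iff by auto
  have cont: "continuous_on UNIV f"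
    using f by (simp add: equi_class_def)
  have mod: "\<bar>f (a + u + b) - f (a + b)\<bar> \<le> e" if "u \<in> U" for a b u
    using f that by (simp add: equi_class_def bi_modulus_def)
  have ex: "\<exists>y\<in>Y. \<exists>u\<in>U. z + y = z' + u" if "z \<in> W" "z' \<in> W" for z z'
  proof -
    obtain y where "y \<in> Y" "- (- z + z') + y \<in> U"
      using net[of "- z + z'"] W \<open>z \<in> W\<close> \<open>z' \<in> W\<close> by blast
    moreover have "z + y = z' + (- (- z + z') + y)"
      by (simp add: minus_add add.assoc[symmetric])
    ultimately show ?thesis by blast
  qed
  have le: "a / ?N\<^sup>2 \<le> (1 - 1 / ?N) * d + e * ?m / ?N"
    if "a \<le> ?N * ((?N - 1) * d + e * ?m)" for a
  proof -
    have "a / ?N\<^sup>2 \<le> ?N * ((?N - 1) * d + e * ?m) / ?N\<^sup>2"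
      using that by (rule divide_right_mono) simp
    also have "\<dots> = (1 - 1 / ?N) * d + e * ?m / ?N"
      using N by (simp add: field_simps power2_eq_square)
    finally show ?thesis .
  qed
  have left: "(\<Sum>x\<in>Y. \<phi> (\<lambda>g. f (z + x + g - y))) - (\<Sum>x\<in>Y. \<phi> (\<lambda>g. f (z' + x + g - y)))
      \<le> (?N - 1) * d + e * ?m" for y
  proof (rule average_contraction[where H = "\<lambda>t. \<phi> (\<lambda>g. f (t + g - y))", OF Y W(1) _ _ z])
    have fy: "(\<lambda>g. f (g - y)) \<in> equi_class U e C"
      using equi_class_translate[OF cg f, of 0 y] by simp
    show "\<phi> (\<lambda>g. f (z + g - y)) - \<phi> (\<lambda>g. f (z' + g - y)) \<le> d" if "z \<in> W" "z' \<in> W" for z z'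
      using bspec[OF osc[unfolded osc_bound_def] fy] that by simp
    show "\<exists>x\<in>Y. \<phi> (\<lambda>g. f (z + x + g - y)) \<le> \<phi> (\<lambda>g. f (z' + g - y)) + e * ?m"
      if "z \<in> W" "z' \<in> W" for z z'
    proof -
      obtain x u where xu: "x \<in> Y" "u \<in> U" "z + x = z' + u"
        using ex \<open>z \<in> W\<close> \<open>z' \<in> W\<close> by blast
      have "f (z + x + g - y) \<le> f (z' + g - y) + e" for g
        using mod[OF xu(2), of z' "g - y"] by (simp add: xu(3) add_diff_eq)
      then have "\<phi> (\<lambda>g. f (z + x + g - y)) \<le> \<phi> (\<lambda>g. f (z' + g - y)) + e * ?m"
        by (intro positive_functional_le_diff[OF pf] continuous_on_translate[OF cg cont])
      then show ?thesis using xu(1) by blast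
    qed
  qed
  have right: "(\<Sum>y\<in>Y. \<phi> (\<lambda>g. f (x + g - (z + y)))) - (\<Sum>y\<in>Y. \<phi> (\<lambda>g. f (x + g - (z' + y))))
      \<le> (?N - 1) * d + e * ?m" for x
  proof (rule average_contraction[where H = "\<lambda>t. \<phi> (\<lambda>g. f (x + g - t))", OF Y W(1) _ _ z])
    have fx: "(\<lambda>g. f (x + g)) \<in> equi_class U e C"
      using equi_class_translate[OF cg f, of x 0] by simp
    show "\<phi> (\<lambda>g. f (x + g - z)) - \<phi> (\<lambda>g. f (x + g - z')) \<le> d" if "z \<in> W" "z' \<in> W" for z z'
      using bspec[OF osc[unfolded osc_bound_def] fx] that by (simp add: add_diff_eq)
    show "\<exists>y\<in>Y. \<phi> (\<lambda>g. f (x + g - (z + y))) \<le> \<phi> (\<lambda>g. f (x + g - z')) + e * ?m"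
      if "z \<in> W" "z' \<in> W" for z z'
    proof -
      obtain y u where yu: "y \<in> Y" "u \<in> U" "z + y = z' + u"
        using ex \<open>z \<in> W\<close> \<open>z' \<in> W\<close> by blast
      have "f (x + g - (z + y)) \<le> f (x + g - z') + e" for g
      proof -
        \<comment> \<open>Negating \<open>z' + u\<close> reverses the order, so \<open>u\<close>
          again ends up between a left factor \<open>x + g - u\<close> and a right factor
          \<open>- z'\<close>, as the modulus requires.\<close>
        have "x + g - (z + y) = x + g - u - z'"
          by (simp add: yu(3) minus_add add.assoc diff_conv_add_uminus del: add_uminus_conv_diff)
        then show ?thesis
          using mod[OF yu(2), of "x + g - u" "- z'"] by simp
      qed
      then have "\<phi> (\<lambda>g. f (x + g - (z + y))) \<le> \<phi> (\<lambda>g. f (x + g - z')) + e * ?m"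
        by (intro positive_functional_le_diff[OF pf] continuous_on_translate[OF cg cont])
      then show ?thesis using yu(1) by blast
    qed
  qed
  have eq: "average Y \<phi> (\<lambda>g. f (z + g)) =
      (\<Sum>y\<in>Y. \<Sum>x\<in>Y. \<phi> (\<lambda>g. f (z + x + g - y))) / ?N\<^sup>2" for z
    unfolding average_def by (subst sum.swap) (simp add: add.assoc diff_conv_add_uminus del: add_uminus_conv_diff)
  show "average Y \<phi> (\<lambda>g. f (z + g)) - average Y \<phi> (\<lambda>g. f (z' + g))
      \<le> (1 - 1 / ?N) * d + e * ?m / ?N"
    unfolding eq diff_divide_distrib[symmetric] sum_subtractf[symmetric]
  proof (rule le)
    show "(\<Sum>y\<in>Y. (\<Sum>x\<in>Y. \<phi> (\<lambda>g. f (z + x + g - y)) - \<phi> (\<lambda>g. f (z' + x + g - y))))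
        \<le> ?N * ((?N - 1) * d + e * ?m)"
      using left by (intro sum_bounded_above) (simp add: sum_subtractf)
  qed
  have eq: "average Y \<phi> (\<lambda>g. f (g - z)) =
      (\<Sum>x\<in>Y. \<Sum>y\<in>Y. \<phi> (\<lambda>g. f (x + g - (z + y)))) / ?N\<^sup>2" for z
    unfolding average_def by (simp add: minus_add add.assoc diff_conv_add_uminus del: add_uminus_conv_diff)
  show "average Y \<phi> (\<lambda>g. f (g - z)) - average Y \<phi> (\<lambda>g. f (g - z'))
      \<le> (1 - 1 / ?N) * d + e * ?m / ?N"
    unfolding eq diff_divide_distrib[symmetric] sum_subtractf[symmetric]
  proof (rule le)
    show "(\<Sum>x\<in>Y. (\<Sum>y\<in>Y. \<phi> (\<lambda>g. f (x + g - (z + y))) - \<phi> (\<lambda>g. f (x + g - (z' + y)))))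
        \<le> ?N * ((?N - 1) * d + e * ?m)"
      using right by (intro sum_bounded_above) (simp add: sum_subtractf)
  qed
qed

lemma positive_functional_average:
  fixes \<phi> :: "('g::{group_add,t2_space} \<Rightarrow> real) \<Rightarrow> real"
  assumes cg: "compact_group TYPE('g)" and pf: "positive_functional \<phi>"
  shows "positive_functional (average Y \<phi>)"
  unfolding positive_functional_def
proof (intro conjI allI impI)
  fix f g :: "'g \<Rightarrow> real" and a :: real
  assume f: "continuous_on UNIV f"
  note ft = continuous_on_translate(1)[OF cg f]
  show "average Y \<phi> (\<lambda>x. a * f x) = a * average Y \<phi> f"
    by (simp add: average_def positive_functional_scale[OF pf ft] sum_distrib_left)
  show "0 \<le> average Y \<phi> f" if "\<forall>x. 0 \<le> f x"
    unfolding average_def using that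
    by (intro divide_nonneg_nonneg sum_nonneg positive_functional_nonneg[OF pf ft]) auto
  assume g: "continuous_on UNIV g"
  show "average Y \<phi> (\<lambda>x. f x + g x) = average Y \<phi> f + average Y \<phi> g"
    by (simp add: average_def positive_functional_add[OF pf ft continuous_on_translate(1)[OF cg g]]
        sum.distrib add_divide_distrib)
qed

lemma average_one:
  "finite Y \<Longrightarrow> Y \<noteq> {} \<Longrightarrow> average Y \<phi> (\<lambda>x. 1) = \<phi> (\<lambda>x. 1)"
  by (simp add: average_def power2_eq_square)

text \<open>The recursion for the bound has the fixed point
  \<open>e * \<phi> (\<lambda>x. 1)\<close>, and the distance to it shrinks by the factor
  \<open>1 - 1 / card Y\<close> each time. It starts at \<open>2 * C\<close> times the mass, as
  functions in the class are bounded by \<open>C\<close>.\<close>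

lemma osc_bound_funpow_average:
  fixes \<phi> :: "('g::{group_add,t2_space} \<Rightarrow> real) \<Rightarrow> real"
  assumes cg: "compact_group TYPE('g)" and pf: "positive_functional \<phi>"
    and Y: "finite Y" "Y \<subseteq> W" "Y \<noteq> {}"
    and W: "\<And>x y. x \<in> W \<Longrightarrow> y \<in> W \<Longrightarrow> x + y \<in> W" "\<And>x. x \<in> W \<Longrightarrow> - x \<in> W"
    and net: "\<And>t. t \<in> W \<Longrightarrow> \<exists>y\<in>Y. - t + y \<in> U"
  shows "positive_functional ((average Y ^^ n) \<phi>) \<and> (average Y ^^ n) \<phi> (\<lambda>x. 1) = \<phi> (\<lambda>x. 1) \<and>
    osc_bound W (equi_class U e C) ((average Y ^^ n) \<phi>)
      ((1 - 1 / real (card Y)) ^ n * (2 * C * \<phi> (\<lambda>x. 1)) + e * \<phi> (\<lambda>x. 1))"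
proof (induction n)
  case 0
  have *: "\<phi> p - \<phi> q \<le> 2 * C * \<phi> (\<lambda>x. 1) + e * \<phi> (\<lambda>x. 1)"
    if "\<And>x. \<bar>p x\<bar> \<le> C" "\<And>x. \<bar>q x\<bar> \<le> C" "continuous_on UNIV p" "continuous_on UNIV q" "0 \<le> e" for p q
  proof -
    have "p x \<le> q x + (2 * C + e)" for x
      using that(1,2)[of x] \<open>0 \<le> e\<close> by linarith
    then have "\<phi> p \<le> \<phi> q + (2 * C + e) * \<phi> (\<lambda>x. 1)"
      by (intro positive_functional_le_diff[OF pf that(3,4)])
    then show ?thesis by (simp add: algebra_simps)
  qed
  \<comment> \<open>The sign of \<open>e\<close> is read off from the modulus: once there are a
    function in the class and a point of \<open>W\<close>, the net provides some
    \<open>u \<in> U\<close>, and \<open>e\<close> bounds an absolute value.\<close>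
  have "0 \<le> e" if "f \<in> equi_class U e C" "z \<in> W" for f :: "'g \<Rightarrow> real" and z
  proof -
    obtain u where "u \<in> U"
      using net \<open>z \<in> W\<close> by blast
    then have "\<bar>f (0 + u + 0) - f (0 + 0)\<bar> \<le> e"
      using that(1) unfolding equi_class_def bi_modulus_def by blast
    then show ?thesis by linarith
  qed
  then have "osc_bound W (equi_class U e C) \<phi> (2 * C * \<phi> (\<lambda>x. 1) + e * \<phi> (\<lambda>x. 1))"
    unfolding osc_bound_def
    by (intro ballI conjI *) (auto simp: equi_class_def intro: continuous_on_translate[OF cg])
  then show ?case
    using pf by simp
next
  case (Suc n)
  let ?\<psi> = "(average Y ^^ n) \<phi>" and ?m = "\<phi> (\<lambda>x. 1)" and ?N = "real (card Y)"
  have N: "0 < ?N"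
    using Y card_gt_0_iff by auto
  have "(1 - 1 / ?N) * ((1 - 1 / ?N) ^ n * (2 * C * ?m) + e * ?m) + e * ?\<psi> (\<lambda>x. 1) / ?N
      = (1 - 1 / ?N) ^ Suc n * (2 * C * ?m) + e * ?m"
    using Suc N by (simp add: algebra_simps)
  then show ?case
    using osc_bound_average[OF cg _ Y W net, of ?\<psi> e C "(1 - 1 / ?N) ^ n * (2 * C * ?m) + e * ?m"] Suc
      positive_functional_average[OF cg, of ?\<psi> Y] average_one[OF Y(1,3), of ?\<psi>]
    by simp
qed

subsection \<open>Functionals of feasible dual solutions\<close>

lemma cnonneg_add: "cnonneg a \<Longrightarrow> cnonneg b \<Longrightarrow> cnonneg (a + b)"
  by (simp add: cnonneg_def)

lemma cnonneg_sum: "(\<And>i. i \<in> I \<Longrightarrow> cnonneg (f i)) \<Longrightarrow> cnonneg (\<Sum>i\<in>I. f i)"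
  by (simp add: cnonneg_def sum_nonneg)

lemma cnonneg_divide_of_real: "cnonneg a \<Longrightarrow> 0 \<le> r \<Longrightarrow> cnonneg (a / complex_of_real r)"
  by (simp add: cnonneg_def Re_divide_of_real Im_divide_of_real)

text \<open>Reindexing by a bijection frees the quadratic form from initial segments of the
  naturals, so that pairs can serve as indices below.\<close>

lemma pos_def_fun_sum:
  fixes c :: "'i \<Rightarrow> complex"
  assumes "pos_def_fun f" "finite I"
  shows "cnonneg (\<Sum>i\<in>I. \<Sum>j\<in>I. cnj (c i) * f (- g i + g j) * c j)"
proof -
  obtain h where h: "bij_betw h {..<card I} I"
    using ex_bij_betw_nat_finite[OF assms(2)] by (auto simp: atLeast0LessThan)
  have "cnonneg (\<Sum>i<card I. \<Sum>j<card I. cnj (c (h i)) * f (- g (h i) + g (h j)) * c (h j))"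
    using assms(1)[unfolded pos_def_fun_def, rule_format, of "\<lambda>i. c (h i)" "\<lambda>i. g (h i)"] .
  also have "(\<Sum>i<card I. \<Sum>j<card I. cnj (c (h i)) * f (- g (h i) + g (h j)) * c (h j)) =
      (\<Sum>i<card I. \<Sum>j\<in>I. cnj (c (h i)) * f (- g (h i) + g j) * c j)"
    by (intro sum.cong refl sum.reindex_bij_betw[OF h])
  also have "\<dots> = (\<Sum>i\<in>I. \<Sum>j\<in>I. cnj (c i) * f (- g i + g j) * c j)"
    by (rule sum.reindex_bij_betw[OF h])
  finally show ?thesis .
qed

text \<open>The quadratic form at the points \<open>0\<close> and \<open>t\<close> with coefficients
  1 and -1.\<close>

lemma pos_def_fun_symmetric_le:
  assumes "pos_def_fun f"
  shows "cnonneg ((f 0 - f t) + (f 0 - f (- t)))"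
  using pos_def_fun_sum[OF assms, of "{0, 1::nat}" "\<lambda>i. if i = 0 then 1 else - 1" "\<lambda>i. if i = 0 then 0 else t"]
  by (simp add: algebra_simps)

text \<open>The form of the average at points \<open>g i\<close> is, up to the positive
  normalisation, the form of \<open>f\<close> at the points \<open>g i - x\<close> indexed by the
  pairs \<open>(i, x)\<close>, with coefficients \<open>c i\<close> independent of
  \<open>x\<close>.\<close>

lemma pos_def_fun_translate_sum:
  assumes f: "pos_def_fun f" and "finite Y"
  shows "pos_def_fun (\<lambda>g. (\<Sum>x\<in>Y. \<Sum>y\<in>Y. f (x + g - y)) / of_real ((real (card Y))\<^sup>2))"
  unfolding pos_def_fun_def
proof (intro allI)
  fix n and c :: "nat \<Rightarrow> complex" and g :: "nat \<Rightarrow> 'a"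
  let ?N = "complex_of_real ((real (card Y))\<^sup>2)"
  have "cnonneg (\<Sum>p\<in>{..<n} \<times> Y. \<Sum>q\<in>{..<n} \<times> Y.
      cnj (c (fst p)) * f (- (g (fst p) - snd p) + (g (fst q) - snd q)) * c (fst q))"
    by (rule pos_def_fun_sum[OF f]) (use \<open>finite Y\<close> in auto)
  also have "(\<Sum>p\<in>{..<n} \<times> Y. \<Sum>q\<in>{..<n} \<times> Y.
      cnj (c (fst p)) * f (- (g (fst p) - snd p) + (g (fst q) - snd q)) * c (fst q)) =
     (\<Sum>i<n. \<Sum>x\<in>Y. \<Sum>j<n. \<Sum>y\<in>Y. cnj (c i) * f (x + (- g i + g j) - y) * c j)"
    by (simp add: sum.cartesian_product' add.assoc diff_conv_add_uminus minus_add del: add_uminus_conv_diff)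
  also have "\<dots> = (\<Sum>i<n. \<Sum>j<n. \<Sum>x\<in>Y. \<Sum>y\<in>Y. cnj (c i) * f (x + (- g i + g j) - y) * c j)"
    by (intro sum.cong refl sum.swap)
  finally have "cnonneg ((\<Sum>i<n. \<Sum>j<n. \<Sum>x\<in>Y. \<Sum>y\<in>Y. cnj (c i) * f (x + (- g i + g j) - y) * c j) / ?N)"
    by (intro cnonneg_divide_of_real) auto
  also have "(\<Sum>i<n. \<Sum>j<n. \<Sum>x\<in>Y. \<Sum>y\<in>Y. cnj (c i) * f (x + (- g i + g j) - y) * c j) / ?N =
    (\<Sum>i<n. \<Sum>j<n. cnj (c i) * ((\<Sum>x\<in>Y. \<Sum>y\<in>Y. f (x + (- g i + g j) - y)) / ?N) * c j)"
    by (simp add: sum_divide_distrib sum_distrib_left sum_distrib_right)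
  finally show "cnonneg (\<Sum>i<n. \<Sum>j<n. cnj (c i) *
      ((\<Sum>x\<in>Y. \<Sum>y\<in>Y. f (x + (- g i + g j) - y)) / ?N) * c j)" .
qed

text \<open>Positivity of \<open>\<delta>_e - p * p*\<close>, with \<open>p\<close> uniform on
  \<open>Y\<close>: add the symmetric inequality for \<open>t = x - y\<close> over all pairs.
  Swapping \<open>x\<close> and \<open>y\<close> shows that each difference is counted twice, hence
  the 2 in the divisor.\<close>

lemma pos_def_fun_translate_sum_le:
  assumes f: "pos_def_fun f" and Y: "finite Y" "Y \<noteq> {}"
  shows "cnonneg (f 0 - (\<Sum>x\<in>Y. \<Sum>y\<in>Y. f (x + 0 - y)) / of_real ((real (card Y))\<^sup>2))"
proof -
  let ?N = "complex_of_real ((real (card Y))\<^sup>2)"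
  have N: "?N \<noteq> 0"
    using Y by simp
  have "cnonneg ((\<Sum>x\<in>Y. \<Sum>y\<in>Y. (f 0 - f (x - y)) + (f 0 - f (- (x - y)))) / complex_of_real (2 * (real (card Y))\<^sup>2))"
    by (intro cnonneg_divide_of_real cnonneg_sum pos_def_fun_symmetric_le[OF f]) auto
  also have "(\<Sum>x\<in>Y. \<Sum>y\<in>Y. (f 0 - f (x - y)) + (f 0 - f (- (x - y)))) =
      (\<Sum>x\<in>Y. \<Sum>y\<in>Y. f 0 - f (x - y)) + (\<Sum>x\<in>Y. \<Sum>y\<in>Y. f 0 - f (y - x))"
    by (simp only: sum.distrib minus_diff_eq)
  also have "(\<Sum>x\<in>Y. \<Sum>y\<in>Y. f 0 - f (y - x)) = (\<Sum>x\<in>Y. \<Sum>y\<in>Y. f 0 - f (x - y))"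
    by (rule sum.swap)
  also have "(\<Sum>x\<in>Y. \<Sum>y\<in>Y. f 0 - f (x - y)) = ?N * f 0 - (\<Sum>x\<in>Y. \<Sum>y\<in>Y. f (x - y))"
    by (simp add: sum_subtractf power2_eq_square)
  also have "(?N * f 0 - (\<Sum>x\<in>Y. \<Sum>y\<in>Y. f (x - y)) + (?N * f 0 - (\<Sum>x\<in>Y. \<Sum>y\<in>Y. f (x - y)))) /
      complex_of_real (2 * (real (card Y))\<^sup>2) = f 0 - (\<Sum>x\<in>Y. \<Sum>y\<in>Y. f (x + 0 - y)) / ?N"
    using N by (simp add: field_simps)
  finally show ?thesis .
qed

section \<open>Integrals of continuous functions and translation invariance of Haar measure\<close>

lemma radon_finite_measure: "radon M \<Longrightarrow> finite_measure M"
  by (auto simp: radon_def intro!: finite_measureI)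

lemma radon_borel_measurable:
  "radon M \<Longrightarrow> continuous_on UNIV f \<Longrightarrow> f \<in> measurable M borel"
  using borel_measurable_continuous_onI by (auto simp: radon_def cong: measurable_cong_sets)

lemma radon_integrable_continuous:
  fixes f :: "'g::t2_space \<Rightarrow> 'b::{banach, second_countable_topology}"
  assumes "compact (UNIV :: 'g set)" "radon M" "continuous_on UNIV f"
  shows "integrable M f"
proof -
  interpret finite_measure M by (rule radon_finite_measure[OF assms(2)])
  have "bounded (range f)"
    using compact_continuous_image[OF assms(3,1)] by (rule compact_imp_bounded)
  then obtain C where "\<And>x. norm (f x) \<le> C"
    by (auto simp: bounded_iff)
  then show ?thesis
    by (intro integrable_const_bound[of _ C] radon_borel_measurable assms) auto
qed

text \<open>The preimage of \<open>B\<close> under the two-sided translation is the left translate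
  of \<open>B\<close> by \<open>- x\<close> followed by the right translate by \<open>y\<close>, so
  both invariances together fix the distribution.\<close>

lemma haar_integral_translate:
  fixes \<nu> :: "'g::{group_add,t2_space} measure" and f :: "'g \<Rightarrow> 'b::{banach, second_countable_topology}"
  assumes cg: "compact_group TYPE('g)" and "haar_prob \<nu>" and f: "continuous_on UNIV f"
  shows "integral\<^sup>L \<nu> (\<lambda>g. f (x + g - y)) = integral\<^sup>L \<nu> f"
proof -
  have r: "radon \<nu>" and sets: "sets \<nu> = sets borel"
    and inv: "\<And>g B. B \<in> sets borel \<Longrightarrow> emeasure \<nu> ((\<lambda>x. g + x) ` B) = emeasure \<nu> B"
      "\<And>g B. B \<in> sets borel \<Longrightarrow> emeasure \<nu> ((\<lambda>x. x + g) ` B) = emeasure \<nu> B"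
    using assms(2) by (auto simp: haar_prob_def radon_def)
  have c: "continuous_on UNIV (\<lambda>g. x + g - y)" "continuous_on UNIV (\<lambda>g. x + g)"
    using continuous_on_translate[OF cg continuous_on_id] by auto
  have "distr \<nu> borel (\<lambda>g. x + g - y) = \<nu>"
  proof (rule measure_eqI)
    fix B assume "B \<in> sets (distr \<nu> borel (\<lambda>g. x + g - y))"
    then have B: "B \<in> sets borel" by simp
    have eq: "(\<lambda>g. - x + g) ` B = (\<lambda>g. x + g) -` B"
      by (force simp: image_iff add.assoc[symmetric])
    have B': "(\<lambda>g. - x + g) ` B \<in> sets borel"
      using measurable_sets[OF borel_measurable_continuous_onI[OF c(2)] B] eq by simp
    have "(\<lambda>g. x + g - y) -` B = (\<lambda>g. g + y) ` ((\<lambda>g. - x + g) ` B)"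
      unfolding eq by (force simp: image_iff add_diff_eq[symmetric] intro: bexI[of _ "_ - y"])
    then have "emeasure \<nu> ((\<lambda>g. x + g - y) -` B) = emeasure \<nu> B"
      using inv(2)[OF B'] inv(1)[OF B] by simp
    then show "emeasure (distr \<nu> borel (\<lambda>g. x + g - y)) B = emeasure \<nu> B"
      using radon_borel_measurable[OF r c(1)] B sets_eq_imp_space_eq[OF sets]
      by (simp add: emeasure_distr)
  qed (simp add: sets)
  then show ?thesis
    using integral_distr[OF radon_borel_measurable[OF r c(1)] borel_measurable_continuous_onI[OF f]]
    by simp
qed

text \<open>Functionals are total on \<open>'g \<Rightarrow> real\<close>; forcing the value 0 on discontinuous functions is what
  makes the set of admissible functionals compact in the product topology.\<close>

definition admissible ::
  "'g::{group_add,t2_space} measure \<Rightarrow> real \<Rightarrow> 'g set \<Rightarrow> real \<Rightarrow> (('g \<Rightarrow> real) \<Rightarrow> real) \<Rightarrow> bool" where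
  "admissible \<nu> c S m \<phi> \<longleftrightarrow> positive_functional \<phi> \<and> \<phi> (\<lambda>x. 1) = m \<and>
     (\<forall>f. \<not> continuous_on UNIV f \<longrightarrow> \<phi> f = 0) \<and>
     (\<forall>f. continuous_on UNIV f \<and> (\<forall>x\<in>S. f x = 0) \<longrightarrow> \<phi> f = 0) \<and>
     (\<forall>F. continuous_on UNIV F \<and> pos_def_fun F \<longrightarrow>
        cnonneg (F 0 + Complex (\<phi> (\<lambda>g. Re (F g))) (\<phi> (\<lambda>g. Im (F g))) - of_real c * integral\<^sup>L \<nu> F))"

section \<open>Averaging stability and compactness of the admissible functionals\<close>

lemma admissible_average:
  fixes \<nu> :: "'g::{group_add,t2_space} measure"
  assumes cg: "compact_group TYPE('g)" and haar: "haar_prob \<nu>"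
    and Y: "finite Y" "Y \<noteq> {}" and S: "\<And>x y s. x \<in> Y \<Longrightarrow> y \<in> Y \<Longrightarrow> s \<in> S \<Longrightarrow> x + s - y \<in> S"
    and adm: "admissible \<nu> c S m \<phi>"
  shows "admissible \<nu> c S m (average Y \<phi>)"
  unfolding admissible_def
proof (intro conjI allI impI)
  have pf: "positive_functional \<phi>" and one: "\<phi> (\<lambda>x. 1) = m"
    and nc: "\<And>f. \<not> continuous_on UNIV f \<Longrightarrow> \<phi> f = 0"
    and supp: "\<And>f. continuous_on UNIV f \<Longrightarrow> (\<And>x. x \<in> S \<Longrightarrow> f x = 0) \<Longrightarrow> \<phi> f = 0"
    and psd: "\<And>F. continuous_on UNIV F \<Longrightarrow> pos_def_fun F \<Longrightarrow>
        cnonneg (F 0 + Complex (\<phi> (\<lambda>g. Re (F g))) (\<phi> (\<lambda>g. Im (F g))) - of_real c * integral\<^sup>L \<nu> F)"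
    using adm by (auto simp: admissible_def)
  show "positive_functional (average Y \<phi>)"
    by (rule positive_functional_average[OF cg pf])
  show "average Y \<phi> (\<lambda>x. 1) = m"
    using average_one[OF Y] one by simp
  fix f :: "'g \<Rightarrow> real"
  show "average Y \<phi> f = 0" if "\<not> continuous_on UNIV f"
    using that by (simp add: average_def nc continuous_on_translate_iff[OF cg])
  show "average Y \<phi> f = 0" if "continuous_on UNIV f \<and> (\<forall>x\<in>S. f x = 0)"
  proof -
    have "\<phi> (\<lambda>g. f (x + g - y)) = 0" if "x \<in> Y" "y \<in> Y" for x y
      using \<open>continuous_on UNIV f \<and> (\<forall>x\<in>S. f x = 0)\<close> that S
      by (intro supp continuous_on_translate[OF cg]) auto
    then show ?thesis
      by (simp add: average_def)
  qed
  fix F :: "'g \<Rightarrow> complex"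
  assume "continuous_on UNIV F \<and> pos_def_fun F"
  then have F: "continuous_on UNIV F" and pd: "pos_def_fun F" by auto
  let ?N = "(real (card Y))\<^sup>2"
  \<comment> \<open>By linearity the averaged functional at \<open>F\<close> is
    \<open>\<phi>\<close> at \<open>F'\<close>, which is again positive definite and has the same
    Haar integral. Positivity of \<open>F 0 - F' 0\<close> then restores the value at the
    identity.\<close>
  define F' where "F' g = (\<Sum>x\<in>Y. \<Sum>y\<in>Y. F (x + g - y)) / complex_of_real ?N" for g
  have F': "continuous_on UNIV F'"
    unfolding F'_def divide_inverse by (intro continuous_intros continuous_on_translate[OF cg F])
  have lin: "\<phi> (\<lambda>g. (\<Sum>x\<in>Y. \<Sum>y\<in>Y. f (x + g - y)) / ?N) = average Y \<phi> f"
    if f: "continuous_on UNIV f" for f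
  proof -
    note ft = continuous_on_translate(1)[OF cg f]
    have "\<phi> (\<lambda>g. (\<Sum>x\<in>Y. \<Sum>y\<in>Y. f (x + g - y)) / ?N) =
        \<phi> (\<lambda>g. (1 / ?N) * (\<Sum>x\<in>Y. \<Sum>y\<in>Y. f (x + g - y)))"
      by simp
    also have "\<dots> = (1 / ?N) * \<phi> (\<lambda>g. \<Sum>x\<in>Y. \<Sum>y\<in>Y. f (x + g - y))"
      by (intro positive_functional_scale[OF pf] continuous_on_sum ft)
    also have "\<phi> (\<lambda>g. \<Sum>x\<in>Y. \<Sum>y\<in>Y. f (x + g - y)) = (\<Sum>x\<in>Y. \<phi> (\<lambda>g. \<Sum>y\<in>Y. f (x + g - y)))"
      by (intro positive_functional_sum[OF pf Y(1)] continuous_on_sum ft)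
    also have "\<dots> = (\<Sum>x\<in>Y. \<Sum>y\<in>Y. \<phi> (\<lambda>g. f (x + g - y)))"
      by (intro sum.cong refl positive_functional_sum[OF pf Y(1)] ft)
    finally show ?thesis
      by (simp add: average_def)
  qed
  have "(\<lambda>g. Re (F' g)) = (\<lambda>g. (\<Sum>x\<in>Y. \<Sum>y\<in>Y. Re (F (x + g - y))) / ?N)"
    "(\<lambda>g. Im (F' g)) = (\<lambda>g. (\<Sum>x\<in>Y. \<Sum>y\<in>Y. Im (F (x + g - y))) / ?N)"
    unfolding F'_def by (simp_all add: Re_divide_of_real Im_divide_of_real del: of_real_power)
  then have ReIm: "\<phi> (\<lambda>g. Re (F' g)) = average Y \<phi> (\<lambda>g. Re (F g))"
    "\<phi> (\<lambda>g. Im (F' g)) = average Y \<phi> (\<lambda>g. Im (F g))"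
    using lin[OF continuous_on_Re[OF F]] lin[OF continuous_on_Im[OF F]] by simp_all
  have rad: "radon \<nu>"
    using haar by (simp add: haar_prob_def)
  have int: "integrable \<nu> (\<lambda>g. F (x + g - y))" for x y
    by (intro radon_integrable_continuous[OF compact_group_compact[OF cg] rad]
        continuous_on_translate[OF cg F])
  have N: "real (card Y) \<noteq> 0"
    using Y by simp
  have "integral\<^sup>L \<nu> F' = (\<Sum>x\<in>Y. \<Sum>y\<in>Y. integral\<^sup>L \<nu> (\<lambda>g. F (x + g - y))) / complex_of_real ?N"
    unfolding F'_def using int by (simp add: Bochner_Integration.integral_sum)
  also have "\<dots> = integral\<^sup>L \<nu> F"
    using N by (simp add: haar_integral_translate[OF cg haar F] power2_eq_square)
  finally have intF: "integral\<^sup>L \<nu> F' = integral\<^sup>L \<nu> F" .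
  have "pos_def_fun F'"
    unfolding F'_def by (rule pos_def_fun_translate_sum[OF pd Y(1)])
  then have "cnonneg (F' 0 + Complex (\<phi> (\<lambda>g. Re (F' g))) (\<phi> (\<lambda>g. Im (F' g))) - of_real c * integral\<^sup>L \<nu> F')"
    by (rule psd[OF F'])
  moreover have "cnonneg (F 0 - F' 0)"
    unfolding F'_def by (rule pos_def_fun_translate_sum_le[OF pd Y])
  ultimately have "cnonneg ((F 0 - F' 0) + (F' 0 + Complex (\<phi> (\<lambda>g. Re (F' g))) (\<phi> (\<lambda>g. Im (F' g)))
      - of_real c * integral\<^sup>L \<nu> F'))"
    by (intro cnonneg_add)
  then show "cnonneg (F 0 + Complex (average Y \<phi> (\<lambda>g. Re (F g))) (average Y \<phi> (\<lambda>g. Im (F g)))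
      - of_real c * integral\<^sup>L \<nu> F)"
    unfolding ReIm intF by (simp add: algebra_simps)
qed

text \<open>Every clause is an equation or weak inequality between finitely many evaluations of
  \<open>\<phi>\<close>, and evaluations are continuous in the product topology.\<close>

lemma closed_admissible: "closed {\<phi>. admissible \<nu> c S m \<phi>}"
proof -
  have ev: "continuous_on UNIV (\<lambda>\<phi> :: ('a \<Rightarrow> real) \<Rightarrow> real. \<phi> f)" for f
    by (rule continuous_on_product_coordinates)
  have "closed {\<phi> :: ('a \<Rightarrow> real) \<Rightarrow> real. positive_functional \<phi>}"
    unfolding positive_functional_def
    by (intro closed_Collect_conj closed_Collect_all closed_Collect_imp open_Collect_const
        closed_Collect_eq closed_Collect_le continuous_on_add continuous_on_mult continuous_on_const ev)
  moreover have "closed {\<phi> :: ('a \<Rightarrow> real) \<Rightarrow> real. \<phi> (\<lambda>x. 1) = m}"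
    by (intro closed_Collect_eq continuous_on_const ev)
  moreover have "closed {\<phi> :: ('a \<Rightarrow> real) \<Rightarrow> real. \<forall>f. \<not> continuous_on UNIV f \<longrightarrow> \<phi> f = 0}"
    by (intro closed_Collect_all closed_Collect_imp open_Collect_const closed_Collect_eq
        continuous_on_const ev)
  moreover have "closed {\<phi> :: ('a \<Rightarrow> real) \<Rightarrow> real.
      \<forall>f. continuous_on UNIV f \<and> (\<forall>x\<in>S. f x = 0) \<longrightarrow> \<phi> f = 0}"
    by (intro closed_Collect_all closed_Collect_imp open_Collect_const closed_Collect_eq
        continuous_on_const ev)
  moreover have "closed {\<phi> :: ('a \<Rightarrow> real) \<Rightarrow> real. cnonneg (z + Complex (\<phi> p) (\<phi> q) - z')}"
    for z z' p q
    unfolding cnonneg_def minus_complex.sel plus_complex.sel complex.sel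
    by (intro closed_Collect_conj closed_Collect_eq closed_Collect_le continuous_on_add
        continuous_on_diff continuous_on_const ev)
  then have "closed {\<phi> :: ('a \<Rightarrow> real) \<Rightarrow> real. \<forall>F. continuous_on UNIV F \<and> pos_def_fun F \<longrightarrow>
        cnonneg (F 0 + Complex (\<phi> (\<lambda>g. Re (F g))) (\<phi> (\<lambda>g. Im (F g))) - of_real c * integral\<^sup>L \<nu> F)}"
    by (intro closed_Collect_all closed_Collect_imp open_Collect_const)
  ultimately show ?thesis
    unfolding admissible_def by (intro closed_Collect_conj)
qed

text \<open>A Banach-Alaoglu argument: positivity gives
  \<open>\<bar>\<phi> f\<bar> \<le> m * sup \<bar>f\<bar>\<close>, and at discontinuous
  \<open>f\<close> the allowed interval shrinks to the point 0. The admissible set is closed in a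
  Tychonoff product of compact intervals.\<close>

lemma compact_admissible:
  fixes \<nu> :: "'g::{group_add,t2_space} measure"
  assumes "compact (UNIV :: 'g set)"
  shows "compact {\<phi>. admissible \<nu> c S m \<phi>}"
proof -
  define b where "b f = (if continuous_on UNIV f then m * (SUP x. \<bar>f x\<bar>) else 0)" for f :: "'g \<Rightarrow> real"
  have "compactin (product_topology (\<lambda>_. euclidean) UNIV) (PiE UNIV (\<lambda>f. {- b f..b f}))"
    by (simp add: compactin_PiE)
  then have "compact (PiE UNIV (\<lambda>f. {- b f..b f}))"
    by (simp add: euclidean_product_topology)
  moreover have "\<phi> \<in> PiE UNIV (\<lambda>f. {- b f..b f})" if "admissible \<nu> c S m \<phi>" for \<phi>
  proof -
    have pf: "positive_functional \<phi>" and m: "\<phi> (\<lambda>x. 1) = m"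
      and nc: "\<And>f. \<not> continuous_on UNIV f \<Longrightarrow> \<phi> f = 0"
      using that by (auto simp: admissible_def)
    have "\<bar>\<phi> f\<bar> \<le> b f" for f
    proof (cases "continuous_on UNIV f")
      case True
      have "bounded (range f)"
        using compact_continuous_image[OF True assms] by (rule compact_imp_bounded)
      then have "bdd_above (range (\<lambda>x. \<bar>f x\<bar>))"
        by (auto simp: bounded_iff bdd_above_def)
      then have le: "\<bar>f x\<bar> \<le> (SUP x. \<bar>f x\<bar>)" for x
        by (rule cSUP_upper2) auto
      have "\<phi> f \<le> \<phi> (\<lambda>x. 0) + (SUP x. \<bar>f x\<bar>) * m"
        unfolding m[symmetric]
      proof (rule positive_functional_le_diff[OF pf True continuous_on_const])
        show "f x \<le> 0 + (SUP x. \<bar>f x\<bar>)" for x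
          using le[of x] by simp
      qed
      moreover have "\<phi> (\<lambda>x. 0) \<le> \<phi> f + (SUP x. \<bar>f x\<bar>) * m"
        unfolding m[symmetric]
      proof (rule positive_functional_le_diff[OF pf continuous_on_const True])
        show "0 \<le> f x + (SUP x. \<bar>f x\<bar>)" for x
          using le[of x] by simp
      qed
      ultimately show ?thesis
        using True positive_functional_zero[OF pf] by (simp add: b_def mult.commute)
    qed (simp add: nc b_def)
    then show ?thesis
      by (simp add: PiE_UNIV_domain abs_le_iff minus_le_iff)
  qed
  then have "{\<phi>. admissible \<nu> c S m \<phi>} = {\<phi>. admissible \<nu> c S m \<phi>} \<inter> PiE UNIV (\<lambda>f. {- b f..b f})"
    by blast
  ultimately show ?thesis
    using closed_Int_compact[OF closed_admissible] by metis
qed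

subsection \<open>Invariant solutions\<close>

text \<open>\<open>Q\<close> collects closed conditions of invariance under one \<open>w\<close>,
  for one \<open>f\<close>, up to an error \<open>d\<close>. Iterated averages satisfy any finitely
  many of them, so compactness yields a functional satisfying all.\<close>

lemma invariant_admissible:
  fixes \<nu> :: "'g::{group_add,t2_space} measure"
  assumes cg: "compact_group TYPE('g)" and haar: "haar_prob \<nu>"
    and W: "closed W" "0 \<in> W" "\<And>x y. x \<in> W \<Longrightarrow> y \<in> W \<Longrightarrow> x + y \<in> W" "\<And>x. x \<in> W \<Longrightarrow> - x \<in> W"
    and S: "\<And>x y s. x \<in> W \<Longrightarrow> y \<in> W \<Longrightarrow> s \<in> S \<Longrightarrow> x + s - y \<in> S"
    and adm: "admissible \<nu> c S m \<phi>0"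
  obtains \<phi> where "admissible \<nu> c S m \<phi>"
    "\<And>f w. continuous_on UNIV f \<Longrightarrow> w \<in> W \<Longrightarrow> \<phi> (\<lambda>g. f (w + g)) = \<phi> f"
    "\<And>f w. continuous_on UNIV f \<Longrightarrow> w \<in> W \<Longrightarrow> \<phi> (\<lambda>g. f (g - w)) = \<phi> f"
proof -
  define I where "I = {(f :: 'g \<Rightarrow> real, w, d :: real). continuous_on UNIV f \<and> w \<in> W \<and> 0 < d}"
  define Q where "Q = (\<lambda>(f :: 'g \<Rightarrow> real, w, d :: real).
    {\<phi>. \<phi> (\<lambda>g. f (w + g)) - \<phi> f \<le> d \<and> \<phi> (\<lambda>g. f (g - w)) - \<phi> f \<le> d})"
  have pf0: "positive_functional \<phi>0" and m: "\<phi>0 (\<lambda>x. 1) = m"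
    using adm by (auto simp: admissible_def)
  have m0: "0 \<le> m"
    using positive_functional_nonneg[OF pf0, of "\<lambda>x. 1"] m by simp
  have "{\<phi>. admissible \<nu> c S m \<phi>} \<inter> (\<Inter>i\<in>I. Q i) \<noteq> {}"
  proof (rule compact_imp_fip_image[OF compact_admissible[OF compact_group_compact[OF cg]]])
    show "closed (Q i)" for i
      unfolding Q_def case_prod_beta
      by (intro closed_Collect_conj closed_Collect_le continuous_intros continuous_on_product_coordinates)
    fix I' assume I': "finite I'" "I' \<subseteq> I"
    \<comment> \<open>The smallest tolerance among the finitely many conditions; inserting 1 covers
      the empty family.\<close>
    obtain \<epsilon> where \<epsilon>: "0 < \<epsilon>" "\<And>i. i \<in> I' \<Longrightarrow> \<epsilon> \<le> snd (snd i)"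
    proof (rule that[of "Min (insert 1 ((\<lambda>i. snd (snd i)) ` I'))"])
      show "0 < Min (insert 1 ((\<lambda>i. snd (snd i)) ` I'))"
        using I' by (subst Min_gr_iff) (auto simp: I_def)
    qed (use I' in auto)
    \<comment> \<open>\<open>e * m\<close> is the error that survives all iterations, so it gets
      half of the tolerance. The \<open>+ 1\<close> handles \<open>m = 0\<close>.\<close>
    define e where "e = \<epsilon> / (2 * (m + 1))"
    have e: "0 < e" "e * m \<le> \<epsilon> / 2"
      using \<epsilon>(1) m0 by (auto simp: e_def field_simps)
    have "\<exists>U. open U \<and> 0 \<in> U \<and> bi_modulus U e (fst i)" if "i \<in> I'" for i
    proof -
      have "continuous_on UNIV (fst i)"
        using that I'(2) by (auto simp: I_def)
      then show ?thesis
        using bi_modulus_exists[OF cg _ e(1)] by metis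
    qed
    then obtain V where V: "\<And>i. i \<in> I' \<Longrightarrow> open (V i) \<and> 0 \<in> V i \<and> bi_modulus (V i) e (fst i)"
      by metis
    define U where "U = (\<Inter>i\<in>I'. V i)"
    have U: "open U" "0 \<in> U" "\<And>i. i \<in> I' \<Longrightarrow> bi_modulus U e (fst i)"
      using V I'(1) by (auto simp: U_def bi_modulus_def)
    have "\<exists>C. 0 \<le> C \<and> (\<forall>x. \<bar>fst i x\<bar> \<le> C)" if "i \<in> I'" for i
    proof -
      have "continuous_on UNIV (fst i)"
        using that I'(2) by (auto simp: I_def)
      then have "bounded (range (fst i))"
        using compact_continuous_image compact_group_compact[OF cg] compact_imp_bounded by blast
      then show ?thesis
        unfolding bounded_iff by (auto intro: order_trans[OF abs_ge_zero])
    qed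
    then obtain D where D: "\<And>i. i \<in> I' \<Longrightarrow> 0 \<le> D i \<and> (\<forall>x. \<bar>fst i x\<bar> \<le> D i)"
      by metis
    \<comment> \<open>Summing the individual bounds puts all functions into one class, for which a
      single net and a single iteration count work.\<close>
    define C where "C = (\<Sum>i\<in>I'. D i)"
    have "0 \<le> C"
      unfolding C_def using D by (intro sum_nonneg) auto
    have E: "fst i \<in> equi_class U e C" if "i \<in> I'" for i
    proof -
      have "D i \<le> C"
        unfolding C_def using D I'(1) that by (intro member_le_sum) auto
      then show ?thesis
        using D[OF that] U(3)[OF that] I'(2) that by (auto simp: equi_class_def I_def intro: order_trans)
    qed
    obtain Y where Y: "finite Y" "Y \<subseteq> W" "Y \<noteq> {}" and net: "\<And>t. t \<in> W \<Longrightarrow> \<exists>y\<in>Y. - t + y \<in> U"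
      using subgroup_finite_net[OF cg W(1,2) U(1,2)] by metis
    let ?r = "1 - 1 / real (card Y)"
    have "1 \<le> card Y"
      using Y by (simp add: Suc_le_eq card_gt_0_iff)
    then have r: "0 \<le> ?r" "?r < 1"
      by auto
    have pos: "0 < 2 * C * m + 1"
      using m0 \<open>0 \<le> C\<close> by (intro add_nonneg_pos mult_nonneg_nonneg) auto
    \<comment> \<open>Enough iterations push the initial oscillation \<open>2 * C * m\<close> below
      the other half of the tolerance; the \<open>+ 1\<close> makes the divisor positive.\<close>
    then obtain n where "?r ^ n < (\<epsilon> / 2) / (2 * C * m + 1)"
      using real_arch_pow_inv[OF _ r(2)] \<epsilon>(1) by (metis divide_pos_pos half_gt_zero)
    then have "?r ^ n * (2 * C * m + 1) \<le> \<epsilon> / 2"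
      unfolding pos_less_divide_eq[OF pos] by (rule less_imp_le)
    moreover have "?r ^ n * (2 * C * m) \<le> ?r ^ n * (2 * C * m + 1)"
      using r by (intro mult_left_mono) auto
    ultimately have small: "?r ^ n * (2 * C * m) + e * m \<le> \<epsilon>"
      using e by linarith
    let ?\<phi> = "(average Y ^^ n) \<phi>0"
    have "admissible \<nu> c S m ((average Y ^^ k) \<phi>0)" for k
    proof (induction k)
      case (Suc k)
      have "x + s - y \<in> S" if "x \<in> Y" "y \<in> Y" "s \<in> S" for x y s
        using S Y(2) that by blast
      from admissible_average[OF cg haar Y(1,3) this Suc.IH] show ?case
        by simp
    qed (simp add: adm)
    moreover have "?\<phi> \<in> Q i" if "i \<in> I'" for i
    proof -
      obtain f w d where i: "i = (f, w, d)"
        by (cases i)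
      have "osc_bound W (equi_class U e C) ?\<phi> (?r ^ n * (2 * C * m) + e * m)"
        using osc_bound_funpow_average[OF cg pf0 Y W(3,4) net, where n = n and e = e and C = C] m by simp
      moreover have "w \<in> W" "f \<in> equi_class U e C" "\<epsilon> \<le> d"
        using that I'(2) E[OF that] \<epsilon>(2)[OF that] by (auto simp: i I_def)
      \<comment> \<open>Comparing \<open>w\<close> with the identity turns oscillation along
        \<open>W\<close> into a defect of invariance.\<close>
      ultimately have "?\<phi> (\<lambda>g. f (w + g)) - ?\<phi> (\<lambda>g. f (0 + g)) \<le> ?r ^ n * (2 * C * m) + e * m"
        "?\<phi> (\<lambda>g. f (g - w)) - ?\<phi> (\<lambda>g. f (g - 0)) \<le> ?r ^ n * (2 * C * m) + e * m"
        using W(2) unfolding osc_bound_def by blast+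
      then show ?thesis
        using small \<open>\<epsilon> \<le> d\<close> by (simp add: i Q_def)
    qed
    ultimately show "{\<phi>. admissible \<nu> c S m \<phi>} \<inter> (\<Inter>i\<in>I'. Q i) \<noteq> {}"
      by blast
  qed
  then obtain \<phi> where \<phi>: "admissible \<nu> c S m \<phi>" "\<And>i. i \<in> I \<Longrightarrow> \<phi> \<in> Q i"
    by blast
  then have pf: "positive_functional \<phi>"
    by (simp add: admissible_def)
  have le: "\<phi> (\<lambda>g. f (w + g)) \<le> \<phi> f" "\<phi> (\<lambda>g. f (g - w)) \<le> \<phi> f"
    if "continuous_on UNIV f" "w \<in> W" for f w
  proof -
    have "\<phi> (\<lambda>g. f (w + g)) \<le> \<phi> f + d \<and> \<phi> (\<lambda>g. f (g - w)) \<le> \<phi> f + d" if "0 < d" for d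
      using \<phi>(2)[of "(f, w, d)"] \<open>continuous_on UNIV f\<close> \<open>w \<in> W\<close> that by (auto simp: I_def Q_def)
    then show "\<phi> (\<lambda>g. f (w + g)) \<le> \<phi> f" "\<phi> (\<lambda>g. f (g - w)) \<le> \<phi> f"
      by (auto intro: field_le_epsilon)
  qed
  show thesis
  proof (rule that[OF \<phi>(1)])
    fix f :: "'g \<Rightarrow> real" and w assume f: "continuous_on UNIV f" and w: "w \<in> W"
    show "\<phi> (\<lambda>g. f (w + g)) = \<phi> f"
      \<comment> \<open>The reverse inequality is the same one for \<open>- w\<close> and the
        translated function.\<close>
      using le(1)[OF f w] le(1)[OF continuous_on_translate(2)[OF cg f, of w] W(4)[OF w]]
      by (simp add: add.assoc[symmetric])
    show "\<phi> (\<lambda>g. f (g - w)) = \<phi> f"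
      using le(2)[OF f w] le(2)[OF continuous_on_translate(3)[OF cg f, of w] W(4)[OF w]]
      by simp
  qed
qed

text \<open>Integration against \<open>\<mu>\<close> is an admissible functional; replace it by an
  invariant one with the same \<open>c\<close>, support and mass, and return to measures by the
  Riesz construction.\<close>

lemma dual_feasible_symmetrize:
  fixes \<nu> \<mu> :: "'g::{group_add,t2_space} measure"
  assumes cg: "compact_group TYPE('g)" and haar: "haar_prob \<nu>"
    and W: "closed W" "0 \<in> W" "\<And>x y. x \<in> W \<Longrightarrow> y \<in> W \<Longrightarrow> x + y \<in> W" "\<And>x. x \<in> W \<Longrightarrow> - x \<in> W"
    and A: "\<And>w. w \<in> W \<Longrightarrow> (\<lambda>a. w + a) ` A = A" "\<And>w. w \<in> W \<Longrightarrow> (\<lambda>a. a + w) ` A = A"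
    and feas: "dual_feasible \<nu> A c \<mu>"
  obtains \<mu>' where "dual_feasible \<nu> A c \<mu>'" "\<And>w. w \<in> W \<Longrightarrow> Lpull w \<mu>' = \<mu>'"
    "\<And>w. w \<in> W \<Longrightarrow> Rpull w \<mu>' = \<mu>'"
proof -
  note comp = compact_group_compact[OF cg]
  have rad: "radon \<mu>" and null: "emeasure \<mu> (UNIV - closure (UNIV - A)) = 0"
    and psd: "dual_psd \<nu> c \<mu>"
    using feas by (auto simp: dual_feasible_def)
  have sp: "space \<mu> = UNIV" and sets: "sets \<mu> = sets borel"
    using rad sets_eq_imp_space_eq[of \<mu> borel] by (auto simp: radon_def)
  interpret finite_measure \<mu> by (rule radon_finite_measure[OF rad])
  define S where "S = closure (UNIV - A)"
  have S: "x + s - y \<in> S" if "x \<in> W" "y \<in> W" "s \<in> S" for x y s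
  proof -
    \<comment> \<open>The complement of \<open>A\<close> is mapped into itself because
      \<open>W\<close> preserves \<open>A\<close> on both sides; continuity extends this to the
      closure.\<close>
    have "(\<lambda>g. x + g - y) ` closure (UNIV - A) \<subseteq> S"
    proof (rule image_closure_subset)
      show "continuous_on (closure (UNIV - A)) (\<lambda>g. x + g - y)"
        using continuous_on_translate(1)[OF cg continuous_on_id] continuous_on_subset by blast
      show "closed S"
        by (simp add: S_def)
      have "t \<in> A" if "x + t - y \<in> A" for t
      proof -
        have "(- x + (x + t - y)) + y \<in> A"
          using A(1)[OF W(4)[OF \<open>x \<in> W\<close>]] A(2)[OF \<open>y \<in> W\<close>] that by blast
        then show ?thesis
          by (simp add: add.assoc diff_conv_add_uminus del: add_uminus_conv_diff)
      qed
      then show "(\<lambda>g. x + g - y) ` (UNIV - A) \<subseteq> S"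
        unfolding S_def using closure_subset by blast
    qed
    then show ?thesis
      using \<open>s \<in> S\<close> unfolding S_def by blast
  qed
  \<comment> \<open>The case split is essential for admissibility: a discontinuous integrable
    function can have nonzero integral.\<close>
  define \<phi>0 where "\<phi>0 f = (if continuous_on UNIV f then integral\<^sup>L \<mu> f else 0)" for f :: "'g \<Rightarrow> real"
  have "admissible \<nu> c S (measure \<mu> UNIV) \<phi>0"
    unfolding admissible_def positive_functional_def
  proof (intro conjI allI impI)
    fix f g :: "'g \<Rightarrow> real" and a :: real
    show "\<phi>0 (\<lambda>x. 1) = measure \<mu> UNIV"
      by (simp add: \<phi>0_def sp)
    show "\<phi>0 f = 0" if "\<not> continuous_on UNIV f"
      using that by (simp add: \<phi>0_def)
    show "\<phi>0 f = 0" if f: "continuous_on UNIV f \<and> (\<forall>x\<in>S. f x = 0)"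
    proof -
      have "UNIV - S \<in> null_sets \<mu>"
        using null by (auto simp: null_sets_def sets S_def)
      then have "AE x in \<mu>. f x = 0"
        by (rule AE_I') (use f in auto)
      then show ?thesis
        using f by (simp add: \<phi>0_def integral_eq_zero_AE)
    qed
    assume f: "continuous_on UNIV f"
    show "\<phi>0 (\<lambda>x. a * f x) = a * \<phi>0 f"
      using f by (simp add: \<phi>0_def continuous_intros)
    show "0 \<le> \<phi>0 f" if "\<forall>x. 0 \<le> f x"
      using that by (simp add: \<phi>0_def)
    assume g: "continuous_on UNIV g"
    show "\<phi>0 (\<lambda>x. f x + g x) = \<phi>0 f + \<phi>0 g"
      using f g radon_integrable_continuous[OF comp rad f] radon_integrable_continuous[OF comp rad g]
      by (simp add: \<phi>0_def continuous_intros)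
  next
    fix F :: "'g \<Rightarrow> complex" assume F: "continuous_on UNIV F \<and> pos_def_fun F"
    then have "integrable \<mu> F"
      using radon_integrable_continuous[OF comp rad] by blast
    then have "Complex (\<phi>0 (\<lambda>g. Re (F g))) (\<phi>0 (\<lambda>g. Im (F g))) = integral\<^sup>L \<mu> F"
      using F by (simp add: \<phi>0_def continuous_intros complex_eq_iff)
    then show "cnonneg (F 0 + Complex (\<phi>0 (\<lambda>g. Re (F g))) (\<phi>0 (\<lambda>g. Im (F g))) - of_real c * integral\<^sup>L \<nu> F)"
      using psd F by (simp add: dual_psd_def)
  qed
  then obtain \<phi> where adm: "admissible \<nu> c S (measure \<mu> UNIV) \<phi>"
    and left: "\<And>f w. continuous_on UNIV f \<Longrightarrow> w \<in> W \<Longrightarrow> \<phi> (\<lambda>g. f (w + g)) = \<phi> f"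
    and right: "\<And>f w. continuous_on UNIV f \<Longrightarrow> w \<in> W \<Longrightarrow> \<phi> (\<lambda>g. f (g - w)) = \<phi> f"
    using invariant_admissible[OF cg haar W S] by blast
  then have pf: "positive_functional \<phi>"
    by (simp add: admissible_def)
  show thesis
  proof (rule that[of "riesz_measure \<phi>"])
    show "dual_feasible \<nu> A c (riesz_measure \<phi>)"
      unfolding dual_feasible_def dual_psd_def S_def[symmetric]
    proof (intro conjI allI impI)
      show rad': "radon (riesz_measure \<phi>)"
        by (rule radon_riesz_measure[OF comp pf])
      show "emeasure (riesz_measure \<phi>) (UNIV - S) = 0"
        using adm by (intro riesz_measure_support[OF comp pf]) (auto simp: S_def admissible_def)
      fix F :: "'g \<Rightarrow> complex" assume F: "continuous_on UNIV F \<and> pos_def_fun F"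
      then have "integrable (riesz_measure \<phi>) F"
        using radon_integrable_continuous[OF comp rad'] by blast
      then have "Complex (\<phi> (\<lambda>g. Re (F g))) (\<phi> (\<lambda>g. Im (F g))) = integral\<^sup>L (riesz_measure \<phi>) F"
        using F integral_riesz_measure[OF comp pf, symmetric]
        by (simp add: continuous_intros complex_eq_iff)
      then show "cnonneg (F 0 + integral\<^sup>L (riesz_measure \<phi>) F - of_real c * integral\<^sup>L \<nu> F)"
        using adm F unfolding admissible_def by metis
    qed
    fix w assume w: "w \<in> W"
    show "Lpull w (riesz_measure \<phi>) = riesz_measure \<phi>"
      unfolding Lpull_def
    \<comment> \<open>\<open>Lpull w\<close> pushes forward along translation by \<open>- w\<close>,
      so left invariance is used for \<open>- w \<in> W\<close>.\<close>
    proof (rule distr_riesz_measure[OF comp pf, where s = "\<lambda>g. w + g"])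
      show "\<phi> (\<lambda>g. f (- w + g)) = \<phi> f" if "continuous_on UNIV f" for f
        by (rule left[OF that W(4)[OF w]])
    qed (simp_all add: continuous_on_group_add[OF cg] add.assoc[symmetric])
    show "Rpull w (riesz_measure \<phi>) = riesz_measure \<phi>"
      unfolding Rpull_def
    proof (rule distr_riesz_measure[OF comp pf, where s = "\<lambda>g. g - w"])
      show "\<phi> (\<lambda>g. f (g + w)) = \<phi> f" if "continuous_on UNIV f" for f
        \<comment> \<open>Right invariance is stated for \<open>g - w\<close>; taking
          \<open>- w\<close> produces \<open>g + w\<close>.\<close>
        using right[OF that W(4)[OF w]] by simp
    qed (simp_all add: continuous_on_group_add[OF cg] continuous_on_group_diff[OF cg])
  qed
qed

theorem theoremA2:
  fixes \<nu> :: "'g::{group_add,t2_space} measure"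
    and A W :: "'g set"
  assumes "compact_group TYPE('g)"
    and "haar_prob \<nu>"
    and "uminus ` A = A" and "0 \<in> A"
    and "closed W" and "0 \<in> W" and "\<forall>x\<in>W. \<forall>y\<in>W. x + y \<in> W" and "\<forall>x\<in>W. - x \<in> W"
    and "\<forall>w\<in>W. (\<lambda>a. w + a) ` A = A \<and> (\<lambda>a. a + w) ` A = A"
  shows "(SUP p\<in>{(c, \<mu>). dual_feasible \<nu> A c \<mu>}. ereal (fst p)) =
         (SUP p\<in>{(c, \<mu>). dual_feasible \<nu> A c \<mu> \<and>
                        (\<forall>w\<in>W. Lpull w \<mu> = \<mu> \<and> Rpull w \<mu> = \<mu>)}. ereal (fst p))"
proof (rule antisym)
  show "(SUP p\<in>{(c, \<mu>). dual_feasible \<nu> A c \<mu>}. ereal (fst p)) \<le>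
         (SUP p\<in>{(c, \<mu>). dual_feasible \<nu> A c \<mu> \<and>
                        (\<forall>w\<in>W. Lpull w \<mu> = \<mu> \<and> Rpull w \<mu> = \<mu>)}. ereal (fst p))"
  \<comment> \<open>Symmetrization keeps \<open>c\<close>, so every feasible value is attained by an
    invariant pair. The other inequality is inclusion of the feasible sets.\<close>
  proof (rule SUP_mono)
    fix p assume "p \<in> {(c, \<mu>). dual_feasible \<nu> A c \<mu>}"
    then obtain c \<mu> where p: "p = (c, \<mu>)" "dual_feasible \<nu> A c \<mu>"
      by auto
    obtain \<mu>' where "dual_feasible \<nu> A c \<mu>'" "\<And>w. w \<in> W \<Longrightarrow> Lpull w \<mu>' = \<mu>'"
      "\<And>w. w \<in> W \<Longrightarrow> Rpull w \<mu>' = \<mu>'"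
      using dual_feasible_symmetrize[OF assms(1,2,5,6) assms(7)[rule_format] assms(8)[rule_format]
          assms(9)[rule_format, THEN conjunct1] assms(9)[rule_format, THEN conjunct2] p(2)] by metis
    then show "\<exists>q\<in>{(c, \<mu>). dual_feasible \<nu> A c \<mu> \<and>
        (\<forall>w\<in>W. Lpull w \<mu> = \<mu> \<and> Rpull w \<mu> = \<mu>)}. ereal (fst p) \<le> ereal (fst q)"
      by (intro bexI[of _ "(c, \<mu>')"]) (auto simp: p)
  qed
qed (rule SUP_subset_mono, auto)

end
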